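(* Let $l\ge 1$ and $d_0,d_1,\dots,d_l\ge 1$ be integers with $d_l=1$, let $d=\max_i d_i$, and consider the set of fully connected ReLU networks $$\mathcal{F}=\{f:\ f(x)=\sigma(W_l\sigma(W_{l-1}\cdots\sigma(W_1x))),\ \forall i\in\{1,\dots,l\}:\ W_i\in\mathbb{R}^{d_i\times d_{i-1}},\ \|W_i\|\le 1\}.$$ Let $\varepsilon>0$ be an arbitrary target approximation error, let $\delta\in(0,1)$, and put $\varepsilon'=(\varepsilon/(d^2l))^l$. Let $$g(x)=\sigma(\varepsilon' B_{l'}\sigma(B_{l'-1}\cdots\sigma(B_1x)))$$ be a randomly initialized network of depth $l'=\Theta(l\log(d^2l/\varepsilon))$ in which every entry of every $B_j$ is drawn (independently) uniformly from $\{-1,+1\}$ and whose layer widths are $$\Theta\left(\log(d^2l/\varepsilon)\cdot\log\left(\frac{dl\log^2(d^2l/\varepsilon)}{\delta}\right)\right)$$ times wider than those of the networks in $\mathcal{F}$ (the exact layout of the layers is given in the context). Then, with probability at least $1-\delta$ over the draw of $B_1,\dots,B_{l'}$, for every $f\in\mathcal{F}$ there exist pruning matrices $M_1,\dots,M_{l'}$ with entries in $\{0,1\}$ ($M_j$ of the same dimensions as $B_j$) such that $$\max_{x\in\mathbb{R}^{d_0}:\ \|x\|\le 1}|f(x)-\tilde g(x)|\le\varepsilon,$$ where $$\tilde g(x):=\sigma(\varepsilon'(M_{l'}\odot B_{l'})\,\sigma((M_{l'-1}\odot B_{l'-1})\cdots\sigma((M_1\odot B_1)x))).$$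
   Context: $\sigma(z)=\max\{z,0\}$ is the ReLU, applied coordinatewise. $\|\cdot\|$ is the Euclidean norm for vectors and the induced operator norm for matrices. $\odot$ is the entrywise product of matrices. $\Theta(\cdot)$ hides absolute constant factors, including those coming from the unspecified (constant) base of the logarithm; the claim is that it holds for suitable choices of these constants. Dimensions of $g$: write $p=d^2l/\varepsilon$. Each layer $i\in\{1,\dots,l\}$ of $f$ corresponds to $\lfloor\log p\rfloor$ consecutive layers of $g$. With $n_i=\Theta\left(d_{i-1}\log(p)\log\left(\frac{dl\log^2(p)}{\delta}\right)\right)$, the matrix $B_{(i-1)\lfloor\log p\rfloor+1}$ is $n_i\times d_{i-1}$, the matrix $B_{i\lfloor\log p\rfloor}$ is $d_i\times n_i$, and the matrices $B_{(i-1)\lfloor\log p\rfloor+k}$ with $1<k<\lfloor\log p\rfloor$ are $n_i\times n_i$. *)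

theory Defs
  imports "HOL-Probability.Product_PMF" "Jordan_Normal_Form.Matrix"
begin

hide_const (open) Finite_Cartesian_Product.vec Finite_Cartesian_Product.mat
hide_type (open) Finite_Cartesian_Product.vec
unbundle no vec_syntax and no inner_syntax

definition relu :: "real \<Rightarrow> real" where
  "relu z = max z 0"

definition vec_norm :: "real vec \<Rightarrow> real" where
  "vec_norm x = sqrt (x \<bullet> x)"

definition mat_opnorm :: "real mat \<Rightarrow> real" where
  "mat_opnorm A = (SUP x \<in> {x \<in> carrier_vec (dim_col A). vec_norm x \<le> 1}. vec_norm (A *\<^sub>v x))"

definition hadamard :: "real mat \<Rightarrow> real mat \<Rightarrow> real mat" (infixl "\<odot>\<^sub>m" 70) where
  "A \<odot>\<^sub>m B = mat (dim_row A) (dim_col A) (\<lambda>(r, c). A $$ (r, c) * B $$ (r, c))"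

text \<open>Layers are numbered from 1; the matrix \<open>W 0\<close> is never used.\<close>

fun relu_net :: "(nat \<Rightarrow> real mat) \<Rightarrow> nat \<Rightarrow> real vec \<Rightarrow> real vec" where
  "relu_net W 0 x = x"
| "relu_net W (Suc k) x = map_vec relu (W (Suc k) *\<^sub>v relu_net W k x)"

definition scaled_relu_net :: "real \<Rightarrow> (nat \<Rightarrow> real mat) \<Rightarrow> nat \<Rightarrow> real vec \<Rightarrow> real vec" where
  "scaled_relu_net s W k = relu_net (W(k := s \<cdot>\<^sub>m W k)) k"

text \<open>The output dimension \<open>d l\<close> is 1, so coordinate 0 is the whole output.\<close>

definition target_nets :: "nat \<Rightarrow> (nat \<Rightarrow> nat) \<Rightarrow> (real vec \<Rightarrow> real) set" where
  "target_nets l d = {\<lambda>x. relu_net W l x $ 0 | W.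
     \<forall>i\<in>{1..l}. W i \<in> carrier_mat (d i) (d (i - 1)) \<and> mat_opnorm (W i) \<le> 1}"

definition max_dim :: "nat \<Rightarrow> (nat \<Rightarrow> nat) \<Rightarrow> nat" where
  "max_dim l d = Max (d ` {0..l})"

definition precision :: "nat \<Rightarrow> (nat \<Rightarrow> nat) \<Rightarrow> real \<Rightarrow> real" where
  "precision l d \<epsilon> = real (max_dim l d) ^ 2 * real l / \<epsilon>"

text \<open>
  Each target layer is simulated by \<open>\<lfloor>log p\<rfloor>\<close> random layers, the first and the last of which
  have different shapes.  This only makes sense for \<open>log p \<ge> 2\<close>.  In that case the truncation
  at 2 below has no effect; it gives the architecture a meaning for every \<open>\<epsilon> > 0\<close>.
\<close>

definition log_precision :: "real \<Rightarrow> nat \<Rightarrow> (nat \<Rightarrow> nat) \<Rightarrow> real \<Rightarrow> real" where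
  "log_precision b l d \<epsilon> = max 2 (log b (precision l d \<epsilon>))"

definition block_depth :: "real \<Rightarrow> nat \<Rightarrow> (nat \<Rightarrow> nat) \<Rightarrow> real \<Rightarrow> nat" where
  "block_depth b l d \<epsilon> = nat \<lfloor>log_precision b l d \<epsilon>\<rfloor>"

definition width_scale :: "real \<Rightarrow> nat \<Rightarrow> (nat \<Rightarrow> nat) \<Rightarrow> real \<Rightarrow> real \<Rightarrow> nat \<Rightarrow> real" where
  "width_scale b l d \<epsilon> \<delta> i =
     real (d (i - 1)) * log_precision b l d \<epsilon> *
     log b (real (max_dim l d) * real l * (log_precision b l d \<epsilon>)\<^sup>2 / \<delta>)"

definition admissible_widths ::
  "real \<Rightarrow> real \<Rightarrow> real \<Rightarrow> nat \<Rightarrow> (nat \<Rightarrow> nat) \<Rightarrow> real \<Rightarrow> real \<Rightarrow> (nat \<Rightarrow> nat) \<Rightarrow> bool" where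
  "admissible_widths b c C l d \<epsilon> \<delta> n \<longleftrightarrow>
     (\<forall>i\<in>{1..l}. c * width_scale b l d \<epsilon> \<delta> i \<le> real (n i) \<and>
                  real (n i) \<le> C * width_scale b l d \<epsilon> \<delta> i)"

text \<open>
  Number of neurons in layer \<open>j\<close> of the random network with blocks of depth \<open>L\<close>: layer \<open>i * L\<close>
  has \<open>d i\<close> neurons, and layer \<open>(i - 1) * L + k\<close> with \<open>1 \<le> k < L\<close> has \<open>n i\<close>.
\<close>

definition layer_width :: "nat \<Rightarrow> (nat \<Rightarrow> nat) \<Rightarrow> (nat \<Rightarrow> nat) \<Rightarrow> nat \<Rightarrow> nat" where
  "layer_width L d n j = (if L dvd j then d (j div L) else n (j div L + 1))"

text \<open>
  Independent uniform signs in the matrices \<open>B 1, \<dots>, B m\<close>, where \<open>B j\<close> is \<open>w j \<times> w (j - 1)\<close>.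
\<close>

definition random_sign_layers :: "(nat \<Rightarrow> nat) \<Rightarrow> nat \<Rightarrow> (nat \<Rightarrow> real mat) pmf" where
  "random_sign_layers w m =
     map_pmf (\<lambda>s j. mat (w j) (w (j - 1)) (\<lambda>(r, c). s (j, r, c)))
       (Pi_pmf {(j, r, c). j \<in> {1..m} \<and> r < w j \<and> c < w (j - 1)} 0 (\<lambda>_. pmf_of_set {-1, 1}))"

definition pruning_masks :: "(nat \<Rightarrow> nat) \<Rightarrow> nat \<Rightarrow> (nat \<Rightarrow> real mat) set" where
  "pruning_masks w m =
     {M. \<forall>j\<in>{1..m}. M j \<in> carrier_mat (w j) (w (j - 1)) \<and> elements_mat (M j) \<subseteq> {0, 1}}"

end

theory Submission
  imports Defs
begin

text \<open>
  Round \<open>p W\<^sub>i\<close> to an integer matrix; dividing by \<open>p\<close> again gives a network whose error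
  accumulates to at most \<open>exp (\<epsilon> / 2) - 1\<close> (for \<open>\<epsilon> \<ge> 1\<close> everything can be pruned away), and the
  scaling factor \<open>\<epsilon>' = (1 / p) ^ l\<close> collects these divisions by positive homogeneity of the ReLU.

  An integer layer is computed exactly by a pruned block of \<open>L\<close> sign layers: the hidden layers
  carry \<open>2\<^sup>k\<close> times the positive and the negative part of each coordinate, one group of neurons for
  each, and the last layer adds the binary digits of the entry with the right sign.  All that is
  needed of the signs is that every neuron finds, in each group of the preceding layer, a
  partner with either sign.  Groups of size of order \<open>log (d l L\<^sup>2 / \<delta>)\<close> make this simultaneously
  true with probability at least \<open>1 - \<delta>\<close>, and the event does not depend on the target network.
\<close>

section \<open>Independent signs\<close>

text \<open>Weights in {-1, 1} on kept edges produce only integer combinations, and repeated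
  doubling reaches magnitudes of order p in logarithmic depth; this dictates both the rounding and
  the depth of a block. Hidden values are nonnegative after the ReLU, so the two signs of a
  coordinate need separate neurons, and the sign of a weight enters only at the last layer.

  The obstacle is dependence: which neurons of a layer are used is decided by choices that look at
  the signs of the following layer. Conditioning layer by layer is avoided by asking for a partner
  for every neuron of the next layer, used or not. The bad events may depend on each other, because
  only a union bound is taken over them; within one bad event the candidates occupy disjoint sets of
  entries and are independent.

  The first layer of a block costs a second sign: a candidate must have the right sign towards its
  successor and also from the coordinate that it reads. Both hold with probability 1/4, hence the
  failure rate 3/4 per candidate.\<close>

lemma prob_pair_pmf_Times:
  "measure_pmf.prob (pair_pmf p q) (X \<times> Y) = measure_pmf.prob p X * measure_pmf.prob q Y"
proof -
  \<comment> \<open>Only the supports carry mass, and they are countable, as the product rule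
    demands.\<close>
  have "measure_pmf.prob (pair_pmf p q) (X \<times> Y) =
      measure_pmf.prob (pair_pmf p q) ((X \<inter> set_pmf p) \<times> (Y \<inter> set_pmf q))"
    by (rule measure_prob_cong_0) (auto simp: pmf_pair set_pmf_iff)
  also have "\<dots> = measure_pmf.prob p (X \<inter> set_pmf p) * measure_pmf.prob q (Y \<inter> set_pmf q)"
    by (rule measure_pmf_prob_product) auto
  finally show ?thesis by (simp add: measure_Int_set_pmf)
qed

text \<open>Each of the at most two prescribed signs is met with probability 1/2. The bound is the
  same for one sign and for two, so the first layer of a block needs no separate count.\<close>

lemma prob_some_sign_wrong:
  fixes \<tau> :: "'i \<Rightarrow> real"
  assumes "finite D" "card D \<le> 2" "\<And>e. e \<in> D \<Longrightarrow> \<tau> e \<in> {-1, 1}"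
  shows "measure_pmf.prob (Pi_pmf D dflt (\<lambda>_. pmf_of_set {-1, 1})) {s. \<exists>e\<in>D. s e \<noteq> \<tau> e} \<le> 3 / 4"
proof -
  let ?P = "Pi_pmf D dflt (\<lambda>_. pmf_of_set {-1, 1 :: real})"
  have "measure_pmf.prob ?P (Pi D (\<lambda>e. {\<tau> e})) = (\<Prod>e\<in>D. measure_pmf.prob (pmf_of_set {-1, 1}) {\<tau> e})"
    by (rule measure_Pi_pmf_Pi) fact
  also have "\<dots> = (\<Prod>e\<in>D. 1 / 2)"
  proof (intro prod.cong refl)
    fix e assume "e \<in> D"
    then show "measure_pmf.prob (pmf_of_set {-1, 1}) {\<tau> e} = 1 / 2"
      using assms(3)[of e] by (auto simp: measure_pmf_single)
  qed
  also have "\<dots> = (1 / 2) ^ card D" by simp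
  also have "\<dots> \<ge> (1 / 2 :: real) ^ 2" using assms(2) by (intro power_decreasing) auto
  finally have "measure_pmf.prob ?P (Pi D (\<lambda>e. {\<tau> e})) \<ge> 1 / 4" by (simp add: power2_eq_square)
  moreover have "{s. \<exists>e\<in>D. s e \<noteq> \<tau> e} = UNIV - Pi D (\<lambda>e. {\<tau> e})" by (auto simp: Pi_def)
  ultimately show ?thesis by (simp add: measure_pmf.prob_compl[simplified])
qed

text \<open>Disjoint coordinate sets make the events independent. The induction splits
  \<open>D u\<close> off the product measure, so the ambient set \<open>A\<close> has to
  vary.\<close>

lemma prob_all_patterns_wrong:
  fixes D :: "'u \<Rightarrow> 'i set" and \<tau> :: "'i \<Rightarrow> real"
  assumes "finite S" "finite A" "disjoint_family_on D S"
    "\<And>u. u \<in> S \<Longrightarrow> D u \<subseteq> A \<and> card (D u) \<le> 2 \<and> (\<forall>e\<in>D u. \<tau> e \<in> {-1, 1})"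
  shows "measure_pmf.prob (Pi_pmf A dflt (\<lambda>_. pmf_of_set {-1, 1}))
           {s. \<forall>u\<in>S. \<exists>e\<in>D u. s e \<noteq> \<tau> e} \<le> (3 / 4) ^ card S"
  using assms
proof (induction S arbitrary: A rule: finite_induct)
  case empty
  then show ?case by simp
next
  case (insert u S)
  let ?P = "\<lambda>A. Pi_pmf A dflt (\<lambda>_. pmf_of_set {-1, 1 :: real})"
  let ?h = "\<lambda>(f, g) x. if x \<in> D u then f x else g x :: real"
  have sub: "D u \<subseteq> A" and fin: "finite (D u)"
    using insert.prems(1,3) by (auto intro: finite_subset)
  have disj: "D v \<inter> D u = {}" if "v \<in> S" for v
    using insert.prems(2) insert.hyps(2) that by (auto simp: disjoint_family_on_def)
  have pre: "?h -` {s. \<forall>v\<in>insert u S. \<exists>e\<in>D v. s e \<noteq> \<tau> e} =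
      {s. \<exists>e\<in>D u. s e \<noteq> \<tau> e} \<times> {s. \<forall>v\<in>S. \<exists>e\<in>D v. s e \<noteq> \<tau> e}"
    using disj by (fastforce simp: disjoint_iff)
  have "D u \<union> (A - D u) = A" using sub by blast
  then have "?P A = map_pmf ?h (pair_pmf (?P (D u)) (?P (A - D u)))"
    using Pi_pmf_union[of "D u" "A - D u" dflt "\<lambda>_. pmf_of_set {-1, 1}"] fin insert.prems(1) by auto
  then have "measure_pmf.prob (?P A) {s. \<forall>v\<in>insert u S. \<exists>e\<in>D v. s e \<noteq> \<tau> e} =
      measure_pmf.prob (?P (D u)) {s. \<exists>e\<in>D u. s e \<noteq> \<tau> e} *
      measure_pmf.prob (?P (A - D u)) {s. \<forall>v\<in>S. \<exists>e\<in>D v. s e \<noteq> \<tau> e}"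
    using pre by (simp add: prob_pair_pmf_Times)
  also have "\<dots> \<le> 3 / 4 * (3 / 4) ^ card S"
  proof (rule mult_mono)
    show "measure_pmf.prob (?P (D u)) {s. \<exists>e\<in>D u. s e \<noteq> \<tau> e} \<le> 3 / 4"
      using insert.prems(3) fin by (intro prob_some_sign_wrong) auto
    show "measure_pmf.prob (?P (A - D u)) {s. \<forall>v\<in>S. \<exists>e\<in>D v. s e \<noteq> \<tau> e} \<le> (3 / 4) ^ card S"
    proof (rule insert.IH)
      show "disjoint_family_on D S" using insert.prems(2) by (auto simp: disjoint_family_on_def)
      show "D v \<subseteq> A - D u \<and> card (D v) \<le> 2 \<and> (\<forall>e\<in>D v. \<tau> e \<in> {-1, 1})" if "v \<in> S" for v
        using insert.prems(3)[of v] disj[OF that] that by blast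
    qed (use insert.prems(1) in auto)
  qed auto
  finally show ?case using insert.hyps by simp
qed

text \<open>Consecutive intervals of length \<open>s\<close>, placed by an enumeration of
  \<open>A\<close>.\<close>

lemma obtain_disjoint_groups:
  fixes A :: "'a set"
  assumes "finite A" "card A * s \<le> n"
  obtains G :: "'a \<Rightarrow> nat set" where "disjoint_family_on G A"
    "\<And>a. a \<in> A \<Longrightarrow> card (G a) = s \<and> G a \<subseteq> {..<n}"
proof -
  obtain f where f: "bij_betw f A {..<card A}"
    using assms(1) ex_bij_betw_finite_nat[of A] by (auto simp: atLeast0LessThan)
  have less: "(f a + 1) * s \<le> n" if "a \<in> A" for a
  proof -
    have "f a < card A" using bij_betwE[OF f] that by auto
    then have "(f a + 1) * s \<le> card A * s" by (intro mult_le_mono1) simp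
    with assms(2) show ?thesis by linarith
  qed
  have disj: "{f a * s..<(f a + 1) * s} \<inter> {f b * s..<(f b + 1) * s} = {}" if "f a < f b" for a b
  proof -
    have "(f a + 1) * s \<le> f b * s" using that by (intro mult_le_mono1) simp
    then show ?thesis by auto
  qed
  show thesis
  proof (rule that)
    show "disjoint_family_on (\<lambda>a. {f a * s..<(f a + 1) * s}) A"
      unfolding disjoint_family_on_def
    proof (intro ballI impI)
      fix a b assume "a \<in> A" "b \<in> A" "a \<noteq> b"
      then have "f a \<noteq> f b" using f by (auto simp: bij_betw_def inj_on_def)
      then show "{f a * s..<(f a + 1) * s} \<inter> {f b * s..<(f b + 1) * s} = {}"
        using disj[of a b] disj[of b a] by (cases "f a < f b") auto
    qed
    show "card {f a * s..<(f a + 1) * s} = s \<and> {f a * s..<(f a + 1) * s} \<subseteq> {..<n}" if "a \<in> A" for a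
      using less[OF that] by auto
  qed
qed

section \<open>Norms and rounding of weights\<close>

lemma vec_norm_eq_L2_set: "vec_norm x = L2_set (vec_index x) {0..<dim_vec x}"
  by (simp add: vec_norm_def L2_set_def scalar_prod_def power2_eq_square)

lemma vec_norm_nonneg [simp]: "0 \<le> vec_norm x"
  by (simp add: vec_norm_eq_L2_set)

lemma vec_norm_add_le:
  assumes "x \<in> carrier_vec n" "y \<in> carrier_vec n"
  shows "vec_norm (x + y) \<le> vec_norm x + vec_norm y"
proof -
  have "vec_norm (x + y) = L2_set (\<lambda>i. x $ i + y $ i) {0..<n}"
    unfolding vec_norm_eq_L2_set using assms by (intro L2_set_cong) auto
  then show ?thesis using assms L2_set_triangle_ineq[of "vec_index x" "vec_index y" "{0..<n}"]
    by (simp add: vec_norm_eq_L2_set)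
qed

lemma vec_norm_smult: "vec_norm (a \<cdot>\<^sub>v x) = \<bar>a\<bar> * vec_norm x"
  by (simp add: vec_norm_def real_sqrt_mult flip: power2_eq_square mult.assoc)

lemma abs_vec_index_le_vec_norm:
  assumes "i < dim_vec x"
  shows "\<bar>x $ i\<bar> \<le> vec_norm x"
proof -
  have "\<bar>x $ i\<bar> = L2_set (vec_index x) {i}" by simp
  also have "\<dots> \<le> vec_norm x"
    unfolding vec_norm_eq_L2_set L2_set_def using assms
    by (intro real_sqrt_le_mono sum_mono2) auto
  finally show ?thesis .
qed

text \<open>Cauchy-Schwarz on each row: the Frobenius bound with every entry replaced by
  \<eta>.\<close>

lemma vec_norm_mult_mat_vec_le_entry_bound:
  assumes A: "A \<in> carrier_mat r c" and x: "x \<in> carrier_vec c" and "0 \<le> \<eta>"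
    and entry: "\<And>i j. i < r \<Longrightarrow> j < c \<Longrightarrow> \<bar>A $$ (i, j)\<bar> \<le> \<eta>"
  shows "vec_norm (A *\<^sub>v x) \<le> sqrt (real r) * sqrt (real c) * \<eta> * vec_norm x"
proof -
  have row: "\<bar>(A *\<^sub>v x) $ i\<bar> \<le> sqrt (real c) * \<eta> * vec_norm x" if i: "i < r" for i
  proof -
    have "\<bar>(A *\<^sub>v x) $ i\<bar> = \<bar>\<Sum>j\<in>{0..<c}. A $$ (i, j) * x $ j\<bar>"
      using A x i by (auto simp: scalar_prod_def intro!: arg_cong[where f = abs] sum.cong)
    also have "\<dots> \<le> (\<Sum>j\<in>{0..<c}. \<bar>A $$ (i, j)\<bar> * \<bar>x $ j\<bar>)"
      using sum_abs[of "\<lambda>j. A $$ (i, j) * x $ j" "{0..<c}"] by (simp add: abs_mult)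
    also have "\<dots> \<le> L2_set (\<lambda>j. A $$ (i, j)) {0..<c} * L2_set (vec_index x) {0..<c}"
      by (rule L2_set_mult_ineq)
    also have "\<dots> \<le> (sqrt (real c) * \<eta>) * vec_norm x"
    proof (rule mult_mono)
      have "(\<Sum>j\<in>{0..<c}. (A $$ (i, j))\<^sup>2) \<le> (\<Sum>j\<in>{0..<c}. \<eta>\<^sup>2)"
        using entry[OF i] assms(3) by (intro sum_mono) (simp add: abs_le_square_iff[symmetric])
      then have "L2_set (\<lambda>j. A $$ (i, j)) {0..<c} \<le> sqrt (real c * \<eta>\<^sup>2)"
        by (simp add: L2_set_def)
      then show "L2_set (\<lambda>j. A $$ (i, j)) {0..<c} \<le> sqrt (real c) * \<eta>"
        using assms(3) by (simp add: real_sqrt_mult)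
    qed (use x assms(3) in \<open>auto simp: vec_norm_eq_L2_set\<close>)
    finally show ?thesis .
  qed
  have "(\<Sum>i\<in>{0..<r}. ((A *\<^sub>v x) $ i)\<^sup>2) \<le> (\<Sum>i\<in>{0..<r}. (sqrt (real c) * \<eta> * vec_norm x)\<^sup>2)"
    using row assms(3) by (intro sum_mono) (simp add: abs_le_square_iff[symmetric])
  then have "vec_norm (A *\<^sub>v x) \<le> sqrt (real r * (sqrt (real c) * \<eta> * vec_norm x)\<^sup>2)"
    using A by (simp add: vec_norm_eq_L2_set L2_set_def)
  also have "\<dots> = sqrt (real r) * sqrt (real c) * \<eta> * vec_norm x"
    using assms(3) by (simp add: real_sqrt_mult)
  finally show ?thesis .
qed

text \<open>Any finite bound serves: it makes the supremum in \<open>mat_opnorm\<close> a genuine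
  upper bound and settles vectors of norm 0.\<close>

lemma mat_entries_bounded: "\<exists>\<eta>\<ge>0. \<forall>i<dim_row A. \<forall>j<dim_col A. \<bar>A $$ (i, j) :: real\<bar> \<le> \<eta>"
proof (intro exI conjI allI impI)
  let ?\<eta> = "\<Sum>i\<in>{0..<dim_row A}. \<Sum>j\<in>{0..<dim_col A}. \<bar>A $$ (i, j)\<bar>"
  show "0 \<le> ?\<eta>" by (intro sum_nonneg) auto
  fix i j assume ij: "i < dim_row A" "j < dim_col A"
  then have "\<bar>A $$ (i, j)\<bar> \<le> (\<Sum>j\<in>{0..<dim_col A}. \<bar>A $$ (i, j)\<bar>)"
    by (intro member_le_sum) auto
  also have "\<dots> \<le> ?\<eta>"
    using ij by (intro member_le_sum[where f = "\<lambda>i. \<Sum>j\<in>{0..<dim_col A}. \<bar>A $$ (i, j)\<bar>"] sum_nonneg) auto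
  finally show "\<bar>A $$ (i, j)\<bar> \<le> ?\<eta>" .
qed

lemma vec_norm_mult_mat_vec_le:
  assumes A: "A \<in> carrier_mat r c" "mat_opnorm A \<le> 1" and x: "x \<in> carrier_vec c"
  shows "vec_norm (A *\<^sub>v x) \<le> vec_norm x"
proof -
  have unit: "vec_norm (A *\<^sub>v y) \<le> 1" if y: "y \<in> carrier_vec c" "vec_norm y \<le> 1" for y
  proof -
    obtain \<eta> where \<eta>: "\<eta> \<ge> 0" "\<forall>i<dim_row A. \<forall>j<dim_col A. \<bar>A $$ (i, j)\<bar> \<le> \<eta>"
      using mat_entries_bounded by blast
    have "bdd_above ((\<lambda>x. vec_norm (A *\<^sub>v x)) ` {x \<in> carrier_vec (dim_col A). vec_norm x \<le> 1})"
    proof (rule bdd_aboveI2)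
      fix z assume z: "z \<in> {x \<in> carrier_vec (dim_col A). vec_norm x \<le> 1}"
      then have "vec_norm (A *\<^sub>v z) \<le> sqrt (real r) * sqrt (real c) * \<eta> * vec_norm z"
        using A \<eta> by (intro vec_norm_mult_mat_vec_le_entry_bound) auto
      also have "\<dots> \<le> sqrt (real r) * sqrt (real c) * \<eta> * 1"
        using z \<eta>(1) by (intro mult_left_mono) auto
      finally show "vec_norm (A *\<^sub>v z) \<le> sqrt (real r) * sqrt (real c) * \<eta>" by simp
    qed
    then have "vec_norm (A *\<^sub>v y) \<le> mat_opnorm A"
      unfolding mat_opnorm_def using y A by (intro cSUP_upper) auto
    with A(2) show ?thesis by simp
  qed
  show ?thesis
  \<comment> \<open>A vector of norm 0 cannot be normalised; there the entry bound already gives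
    0.\<close>
  proof (cases "vec_norm x = 0")
    case True
    obtain \<eta> where \<eta>: "\<eta> \<ge> 0" "\<forall>i<dim_row A. \<forall>j<dim_col A. \<bar>A $$ (i, j)\<bar> \<le> \<eta>"
      using mat_entries_bounded by blast
    then have "vec_norm (A *\<^sub>v x) \<le> sqrt (real r) * sqrt (real c) * \<eta> * vec_norm x"
      using A x by (intro vec_norm_mult_mat_vec_le_entry_bound) auto
    with True show ?thesis by simp
  next
    case False
    then have pos: "vec_norm x > 0" using vec_norm_nonneg[of x] by linarith
    let ?y = "(1 / vec_norm x) \<cdot>\<^sub>v x"
    have "vec_norm (A *\<^sub>v ?y) \<le> 1"
      using x pos by (intro unit) (auto simp: vec_norm_smult)
    also have "A *\<^sub>v ?y = (1 / vec_norm x) \<cdot>\<^sub>v (A *\<^sub>v x)"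
      using A x by (simp add: mult_mat_vec)
    finally show ?thesis using pos by (simp add: vec_norm_smult field_simps)
  qed
qed

lemma abs_entry_le_one:
  assumes A: "A \<in> carrier_mat r c" "mat_opnorm A \<le> 1" and ij: "i < r" "j < c"
  shows "\<bar>A $$ (i, j)\<bar> \<le> 1"
proof -
  have "A *\<^sub>v unit_vec c j = col A j" using A ij by (auto intro!: eq_vecI)
  then have "\<bar>A $$ (i, j)\<bar> = \<bar>(A *\<^sub>v unit_vec c j) $ i\<bar>" using A ij by simp
  also have "\<dots> \<le> vec_norm (A *\<^sub>v unit_vec c j)" using A ij by (intro abs_vec_index_le_vec_norm) auto
  also have "\<dots> \<le> vec_norm (unit_vec c j)" using A by (intro vec_norm_mult_mat_vec_le) auto
  also have "\<dots> = 1" using ij by (simp add: vec_norm_def)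
  finally show ?thesis .
qed

lemma vec_norm_map_relu_diff_le:
  assumes "x \<in> carrier_vec n" "y \<in> carrier_vec n"
  shows "vec_norm (map_vec relu x - map_vec relu y) \<le> vec_norm (x - y)"
proof -
  have *: "\<bar>relu a - relu b\<bar> \<le> \<bar>a - b\<bar>" for a b by (auto simp: relu_def max_def)
  have "(\<Sum>i\<in>{0..<n}. (relu (x $ i) - relu (y $ i))\<^sup>2) \<le> (\<Sum>i\<in>{0..<n}. (x $ i - y $ i)\<^sup>2)"
    using * by (intro sum_mono) (simp add: abs_le_square_iff[symmetric])
  then show ?thesis using assms by (simp add: vec_norm_eq_L2_set L2_set_def)
qed

lemma vec_norm_map_relu_le:
  "vec_norm (map_vec relu x) \<le> vec_norm x"
proof -
  have *: "\<bar>relu a\<bar> \<le> \<bar>a\<bar>" for a by (auto simp: relu_def max_def)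
  have "(\<Sum>i\<in>{0..<dim_vec x}. (relu (x $ i))\<^sup>2) \<le> (\<Sum>i\<in>{0..<dim_vec x}. (x $ i)\<^sup>2)"
    using * by (intro sum_mono) (simp add: abs_le_square_iff[symmetric])
  then show ?thesis by (simp add: vec_norm_eq_L2_set L2_set_def)
qed

section \<open>Propagation of rounding errors through the layers\<close>

lemma relu_net_carrier:
  assumes "\<And>i. 1 \<le> i \<Longrightarrow> i \<le> k \<Longrightarrow> W i \<in> carrier_mat (d i) (d (i - 1))" "x \<in> carrier_vec (d 0)"
  shows "relu_net W k x \<in> carrier_vec (d k)"
  using assms
proof (induction k)
  case (Suc k)
  have "W (Suc k) \<in> carrier_mat (d (Suc k)) (d k)" using Suc.prems(1)[of "Suc k"] by simp
  then have "W (Suc k) *\<^sub>v relu_net W k x \<in> carrier_vec (d (Suc k))"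
    by (rule mult_mat_vec_carrier) (use Suc in auto)
  then show ?case by simp
qed simp

lemma vec_norm_relu_net_le:
  assumes "\<And>i. 1 \<le> i \<Longrightarrow> i \<le> k \<Longrightarrow> W i \<in> carrier_mat (d i) (d (i - 1)) \<and> mat_opnorm (W i) \<le> 1"
    "x \<in> carrier_vec (d 0)" "vec_norm x \<le> 1"
  shows "vec_norm (relu_net W k x) \<le> 1"
  using assms
proof (induction k)
  case (Suc k)
  have W: "W (Suc k) \<in> carrier_mat (d (Suc k)) (d k)" "mat_opnorm (W (Suc k)) \<le> 1"
    using Suc.prems(1)[of "Suc k"] by auto
  have z: "relu_net W k x \<in> carrier_vec (d k)"
    using Suc.prems by (intro relu_net_carrier) auto
  have "vec_norm (relu_net W (Suc k) x) \<le> vec_norm (W (Suc k) *\<^sub>v relu_net W k x)"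
    by (simp add: vec_norm_map_relu_le)
  also have "\<dots> \<le> vec_norm (relu_net W k x)" using W z by (intro vec_norm_mult_mat_vec_le)
  also have "\<dots> \<le> 1" using Suc by auto
  finally show ?case .
qed simp

text \<open>An error \<open>e\<close> before a layer becomes at most
  \<open>e + \<eta> * (1 + e)\<close> after it; adding 1 turns this recurrence into multiplication
  by \<open>1 + \<eta>\<close>.\<close>

lemma vec_norm_relu_net_diff_le:
  assumes W: "\<And>i. 1 \<le> i \<Longrightarrow> i \<le> k \<Longrightarrow> W i \<in> carrier_mat (d i) (d (i - 1)) \<and> mat_opnorm (W i) \<le> 1"
    and V: "\<And>i. 1 \<le> i \<Longrightarrow> i \<le> k \<Longrightarrow> V i \<in> carrier_mat (d i) (d (i - 1))"
    and WV: "\<And>i y. 1 \<le> i \<Longrightarrow> i \<le> k \<Longrightarrow> y \<in> carrier_vec (d (i - 1)) \<Longrightarrow>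
               vec_norm ((W i - V i) *\<^sub>v y) \<le> \<eta> * vec_norm y"
    and x: "x \<in> carrier_vec (d 0)" "vec_norm x \<le> 1" and \<eta>: "0 \<le> \<eta>"
  shows "1 + vec_norm (relu_net W k x - relu_net V k x) \<le> (1 + \<eta>) ^ k"
  using W V WV
proof (induction k)
  case 0
  have "vec_norm (x - x) = 0" using x by (simp add: vec_norm_def)
  then show ?case by simp
next
  case (Suc k)
  define z y where "z = relu_net W k x" and "y = relu_net V k x"
  have Wk: "W (Suc k) \<in> carrier_mat (d (Suc k)) (d k)" "mat_opnorm (W (Suc k)) \<le> 1"
    and Vk: "V (Suc k) \<in> carrier_mat (d (Suc k)) (d k)"
    using Suc.prems(1,2)[of "Suc k"] by auto
  have z: "z \<in> carrier_vec (d k)" "vec_norm z \<le> 1" and y: "y \<in> carrier_vec (d k)"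
    unfolding z_def y_def using Suc.prems x
    by (auto intro!: relu_net_carrier vec_norm_relu_net_le[where d = d])
  have "y = z + - (z - y)" using z y by (intro eq_vecI) auto
  moreover have "vec_norm (- (z - y)) = vec_norm (z - y)"
    using z y by (simp add: vec_norm_def)
  ultimately have ynorm: "vec_norm y \<le> 1 + vec_norm (z - y)"
    using vec_norm_add_le[of z "d k" "- (z - y)"] z y by auto
  \<comment> \<open>This way of splitting uses the norm bound of \<open>W\<close> only; the rounded
    matrix \<open>V\<close> may have norm above 1.\<close>
  have split: "W (Suc k) *\<^sub>v z - V (Suc k) *\<^sub>v y = W (Suc k) *\<^sub>v (z - y) + (W (Suc k) - V (Suc k)) *\<^sub>v y"
    using Wk Vk z y
    by (subst mult_minus_distrib_mat_vec, auto)+ (subst minus_mult_distrib_mat_vec, auto intro!: eq_vecI)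
  have "vec_norm (relu_net W (Suc k) x - relu_net V (Suc k) x) \<le> vec_norm (W (Suc k) *\<^sub>v z - V (Suc k) *\<^sub>v y)"
    using Wk Vk z y by (simp flip: z_def y_def) (rule vec_norm_map_relu_diff_le[where n = "d (Suc k)"], auto)
  also have "\<dots> \<le> vec_norm (W (Suc k) *\<^sub>v (z - y)) + vec_norm ((W (Suc k) - V (Suc k)) *\<^sub>v y)"
    unfolding split using Wk Vk z y
    by (intro vec_norm_add_le[where n = "d (Suc k)"] mult_mat_vec_carrier[where n = "d k"]) auto
  also have "\<dots> \<le> vec_norm (z - y) + \<eta> * vec_norm y"
    using Wk z y Suc.prems(3)[of "Suc k" y] by (intro add_mono vec_norm_mult_mat_vec_le) auto
  also have "\<dots> \<le> vec_norm (z - y) + \<eta> * (1 + vec_norm (z - y))"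
    using ynorm \<eta> by (intro add_left_mono mult_left_mono)
  finally have "1 + vec_norm (relu_net W (Suc k) x - relu_net V (Suc k) x) \<le> (1 + \<eta>) * (1 + vec_norm (z - y))"
    by (simp add: algebra_simps)
  also have "\<dots> \<le> (1 + \<eta>) * (1 + \<eta>) ^ k"
    unfolding z_def y_def using \<eta> Suc by (intro mult_left_mono Suc.IH) auto
  finally show ?case by simp
qed

text \<open>The entry bound is what rounding \<open>p * W i\<close> to integers leaves: 1/2, divided
  by \<open>p = D ^ 2 * l / \<epsilon>\<close>.\<close>

lemma rounded_net_error:
  assumes W: "\<And>i. 1 \<le> i \<Longrightarrow> i \<le> l \<Longrightarrow> W i \<in> carrier_mat (d i) (d (i - 1)) \<and> mat_opnorm (W i) \<le> 1"
    and V: "\<And>i. 1 \<le> i \<Longrightarrow> i \<le> l \<Longrightarrow> V i \<in> carrier_mat (d i) (d (i - 1))"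
    and WV: "\<And>i r c. 1 \<le> i \<Longrightarrow> i \<le> l \<Longrightarrow> r < d i \<Longrightarrow> c < d (i - 1) \<Longrightarrow>
               \<bar>W i $$ (r, c) - V i $$ (r, c)\<bar> \<le> \<epsilon> / (2 * real D ^ 2 * real l)"
    and D: "\<And>i. i \<le> l \<Longrightarrow> d i \<le> D" "1 \<le> D" and l: "1 \<le> l" "d l = 1" and \<epsilon>: "0 < \<epsilon>" "\<epsilon> < 1"
    and x: "x \<in> carrier_vec (d 0)" "vec_norm x \<le> 1"
  shows "\<bar>relu_net W l x $ 0 - relu_net V l x $ 0\<bar> \<le> \<epsilon>"
proof -
  define \<eta> where "\<eta> = \<epsilon> / (2 * real l)"
  have \<eta>: "0 \<le> \<eta>" using \<epsilon> by (simp add: \<eta>_def)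
  have op: "vec_norm ((W i - V i) *\<^sub>v y) \<le> \<eta> * vec_norm y"
    if i: "1 \<le> i" "i \<le> l" and y: "y \<in> carrier_vec (d (i - 1))" for i y
  proof -
    have "vec_norm ((W i - V i) *\<^sub>v y)
        \<le> sqrt (real (d i)) * sqrt (real (d (i - 1))) * (\<epsilon> / (2 * real D ^ 2 * real l)) * vec_norm y"
      using W[OF i] V[OF i] WV[OF i] \<epsilon> y by (intro vec_norm_mult_mat_vec_le_entry_bound) auto
    also have "\<dots> \<le> sqrt (real D) * sqrt (real D) * (\<epsilon> / (2 * real D ^ 2 * real l)) * vec_norm y"
      using D(1)[of i] D(1)[of "i - 1"] i \<epsilon> by (intro mult_right_mono mult_mono) auto
    also have "\<dots> = (\<eta> / real D) * vec_norm y"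
      using D(2) l by (simp add: \<eta>_def power2_eq_square field_simps)
    \<comment> \<open>The Frobenius bound leaves an extra factor \<open>1 / D\<close>, which is
      given away.\<close>
    also have "\<dots> \<le> \<eta> * vec_norm y"
      using D(2) \<eta> by (intro mult_right_mono) (auto simp: divide_le_eq mult_le_cancel_left1)
    finally show ?thesis .
  qed
  have "1 + vec_norm (relu_net W l x - relu_net V l x) \<le> (1 + \<eta>) ^ l"
    using W V op x \<eta> by (intro vec_norm_relu_net_diff_le[where d = d]) auto
  also have "\<dots> \<le> exp \<eta> ^ l" using \<eta> exp_ge_add_one_self[of \<eta>] by (intro power_mono) auto
  also have "\<dots> = exp (\<epsilon> / 2)" using l by (simp add: \<eta>_def flip: exp_of_nat_mult)
  \<comment> \<open>\<open>\<epsilon> < 1\<close> puts \<open>\<epsilon> / 2\<close> in the range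
    where \<open>exp z \<le> 1 + 2 * z\<close>.\<close>
  also have "\<dots> \<le> 1 + \<epsilon>" using exp_bound_lemma[of "\<epsilon> / 2"] \<epsilon> by simp
  finally have *: "vec_norm (relu_net W l x - relu_net V l x) \<le> \<epsilon>" by simp
  have "relu_net W l x \<in> carrier_vec (d l)" "relu_net V l x \<in> carrier_vec (d l)"
    using W V x by (auto intro!: relu_net_carrier)
  then have "\<bar>relu_net W l x $ 0 - relu_net V l x $ 0\<bar> \<le> vec_norm (relu_net W l x - relu_net V l x)"
    using l abs_vec_index_le_vec_norm[of 0 "relu_net W l x - relu_net V l x"] by simp
  with * show ?thesis by simp
qed

section \<open>Simulation of integer layers by sign layers\<close>

lemma nat_eq_sum_bits: "N < 2 ^ n \<Longrightarrow> real N = (\<Sum>k<n. of_bool (bit N k) * 2 ^ k)"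
proof -
  assume "N < 2 ^ n"
  then have "N = take_bit n N" by (simp add: take_bit_nat_eq_self)
  also have "\<dots> = (\<Sum>k<n. of_bool (bit N k) * 2 ^ k)"
    unfolding take_bit_sum push_bit_eq_mult atLeast0LessThan by simp
  finally have "real N = real (\<Sum>k<n. of_bool (bit N k) * 2 ^ k)" by (rule arg_cong)
  also have "\<dots> = (\<Sum>k<n. of_bool (bit N k) * 2 ^ k)" by simp
  finally show ?thesis .
qed

lemma relu_mult_nonneg: "0 \<le> s \<Longrightarrow> relu (s * z) = s * relu z"
  by (simp add: relu_def max_def mult_le_0_iff zero_le_mult_iff)

lemma relu_relu [simp]: "relu (relu z) = relu z"
  by (simp add: relu_def)

text \<open>A mask is given by the kept sources of each target neuron, so that a pruned layer
  becomes a sum over \<open>T v\<close>.\<close>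

definition row_mask :: "nat \<Rightarrow> nat \<Rightarrow> (nat \<Rightarrow> nat set) \<Rightarrow> real mat" where
  "row_mask r c T = mat r c (\<lambda>(v, u). of_bool (u \<in> T v))"

lemma row_mask_carrier [simp]: "row_mask r c T \<in> carrier_mat r c"
  by (simp add: row_mask_def)

lemma elements_row_mask: "elements_mat (row_mask r c T) \<subseteq> {0, 1}"
  by (auto simp: row_mask_def elements_mat_def)

lemma row_mask_hadamard_mult_vec:
  assumes "y \<in> carrier_vec c" "v < r" "T v \<subseteq> {..<c}"
  shows "((row_mask r c T \<odot>\<^sub>m B) *\<^sub>v y) $ v = (\<Sum>u\<in>T v. B $$ (v, u) * y $ u)"
proof -
  have "((row_mask r c T \<odot>\<^sub>m B) *\<^sub>v y) $ v = (\<Sum>u\<in>{0..<c}. of_bool (u \<in> T v) * (B $$ (v, u) * y $ u))"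
    using assms by (simp add: row_mask_def hadamard_def scalar_prod_def mult.assoc)
  also have "\<dots> = (\<Sum>u\<in>T v. of_bool (u \<in> T v) * (B $$ (v, u) * y $ u))"
    using assms by (intro sum.mono_neutral_right) auto
  finally show ?thesis by simp
qed

lemma hadamard_carrier: "A \<in> carrier_mat r c \<Longrightarrow> A \<odot>\<^sub>m B \<in> carrier_mat r c"
  unfolding hadamard_def by (metis carrier_matD mat_carrier)

text \<open>
  A lane \<open>(j, sg, k)\<close> computes \<open>2 ^ k\<close> times the positive part of \<open>sg * x\<^sub>j\<close>: its value is
  doubled from layer to layer until the factor \<open>2 ^ k\<close> is reached, and copied afterwards.
\<close>

definition lanes :: "nat \<Rightarrow> nat \<Rightarrow> (nat \<times> real \<times> nat) set" where
  "lanes n L = {..<n} \<times> {-1, 1} \<times> {..<L - 1}"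

text \<open>
  Each lane has two disjoint groups of neurons, because a doubling step adds two neurons.
  In the first layer of a block a neuron is only usable if its weight from the input has the
  right sign.
\<close>

definition rich_block ::
  "nat \<Rightarrow> nat \<Rightarrow> (nat \<Rightarrow> nat) \<Rightarrow> ((nat \<times> real \<times> nat) \<times> bool \<Rightarrow> nat set) \<Rightarrow> (nat \<Rightarrow> real mat) \<Rightarrow> bool" where
  "rich_block n L w G B \<longleftrightarrow>
     (\<forall>m\<in>{1..<L}. \<forall>v<w (Suc m). \<forall>a\<in>lanes n L. \<forall>h. \<forall>\<nu>\<in>{-1, 1}.
        \<exists>u\<in>G (a, h). B (Suc m) $$ (v, u) = \<nu> \<and> (m = 1 \<longrightarrow> B 1 $$ (u, fst a) = fst (snd a)))"

text \<open>The lanes provide all powers of two whatever \<open>K\<close> is; \<open>K\<close> is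
  consulted only in the last layer, where its binary digits select lanes. The first layer of the
  block only reads and the last only sums, so \<open>L - 2\<close> doublings remain and digits of
  index below \<open>L - 1\<close> are available.\<close>

lemma rich_block_simulates_integer_layer:
  fixes K :: "nat \<Rightarrow> nat \<Rightarrow> int"
  assumes L: "2 \<le> L"
    and B: "\<And>m. 1 \<le> m \<Longrightarrow> m \<le> L \<Longrightarrow> B m \<in> carrier_mat (w m) (w (m - 1))"
    and G_disj: "disjoint_family_on G (lanes (w 0) L \<times> UNIV)"
    and G_sub: "\<And>a h m. a \<in> lanes (w 0) L \<Longrightarrow> 1 \<le> m \<Longrightarrow> m < L \<Longrightarrow> G (a, h) \<subseteq> {..<w m}"
    and rich: "rich_block (w 0) L w G B"
    and K: "\<And>r j. r < w L \<Longrightarrow> j < w 0 \<Longrightarrow> \<bar>K r j\<bar> < 2 ^ (L - 1)"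
  shows "\<exists>M. (\<forall>m\<in>{1..L}. M m \<in> carrier_mat (w m) (w (m - 1)) \<and> elements_mat (M m) \<subseteq> {0, 1}) \<and>
    (\<forall>x\<in>carrier_vec (w 0). relu_net (\<lambda>m. M m \<odot>\<^sub>m B m) L x =
       map_vec relu (mat (w L) (w 0) (\<lambda>(r, j). of_int (K r j)) *\<^sub>v x))"
proof -
  let ?A = "lanes (w 0) L"
  \<comment> \<open>A neuron of layer \<open>m\<close>, in half \<open>h\<close> of lane
    \<open>a\<close>, that feeds neuron \<open>v\<close> of layer \<open>m + 1\<close> with sign
    \<nu>; \<open>rich_block\<close> supplies it.\<close>
  define c where "c m v a h \<nu> = (SOME u. u \<in> G (a, h) \<and> B (Suc m) $$ (v, u) = \<nu> \<and>
      (m = 1 \<longrightarrow> B 1 $$ (u, fst a) = fst (snd a)))" for m v h \<nu> and a :: "nat \<times> real \<times> nat"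
  have c: "c m v a h \<nu> \<in> G (a, h)" "B (Suc m) $$ (v, c m v a h \<nu>) = \<nu>"
      "m = 1 \<longrightarrow> B 1 $$ (c m v a h \<nu>, fst a) = fst (snd a)"
    if "1 \<le> m" "m < L" "v < w (Suc m)" "a \<in> ?A" "\<nu> \<in> {-1, 1}" for m v a h \<nu>
  proof -
    have "\<exists>u. u \<in> G (a, h) \<and> B (Suc m) $$ (v, u) = \<nu> \<and> (m = 1 \<longrightarrow> B 1 $$ (u, fst a) = fst (snd a))"
      using rich[unfolded rich_block_def, rule_format, of m v a \<nu> h] that by auto
    from someI_ex[OF this, folded c_def]
    show "c m v a h \<nu> \<in> G (a, h)" "B (Suc m) $$ (v, c m v a h \<nu>) = \<nu>"
      "m = 1 \<longrightarrow> B 1 $$ (c m v a h \<nu>, fst a) = fst (snd a)" by auto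
  qed
  \<comment> \<open>Each neuron belongs to a single lane and half, so the existential quantifiers in
    \<open>T\<close> below determine its inputs.\<close>
  have uniq: "a = a' \<and> h = h'"
    if "u \<in> G (a, h)" "u \<in> G (a', h')" "a \<in> ?A" "a' \<in> ?A" for u a h a' h'
  proof (rule ccontr)
    assume "\<not> (a = a' \<and> h = h')"
    then have "G (a, h) \<inter> G (a', h') = {}"
      using that(3,4) by (intro disjoint_family_onD[OF G_disj]) auto
    with that(1,2) show False by blast
  qed
  have member: "(a' \<in> ?A \<and> u \<in> G (a', h')) \<longleftrightarrow> a' = a \<and> h' = h"
    if "a \<in> ?A" "u \<in> G (a, h)" for u a h a' h'
  proof
    assume "a' \<in> ?A \<and> u \<in> G (a', h')"
    then show "a' = a \<and> h' = h" using uniq[OF that(2) _ that(1), of a' h'] by simp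
  qed (use that in simp)
  \<comment> \<open>Layer 1 reads the coordinate of the lane. A middle layer takes one neuron from
    half \<open>False\<close>, and a second one from half \<open>True\<close> while the lane still
    doubles. The last layer takes one neuron per set digit; its sign is that of the entry, reversed
    for lanes carrying a negative part.\<close>
  define T where "T m v =
     (if m = 1 then {j. \<exists>a h. (a \<in> ?A \<and> v \<in> G (a, h)) \<and> j = fst a}
      else if m < L then {u. \<exists>a h. (a \<in> ?A \<and> v \<in> G (a, h)) \<and>
        (u = c (m - 1) v a False 1 \<or> m - 1 \<le> snd (snd a) \<and> u = c (m - 1) v a True 1)}
      else {u. \<exists>a. a \<in> ?A \<and> bit (nat \<bar>K v (fst a)\<bar>) (snd (snd a)) \<and>
        u = c (L - 1) v a False (fst (snd a) * of_int (sgn (K v (fst a))))})" for m v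
  \<comment> \<open>A set digit excludes \<open>K v j = 0\<close>, for which \<open>sgn\<close>
    would give no sign.\<close>
  have sgnK: "sg * of_int (sgn (K v j)) \<in> {-1, 1 :: real}"
    if "(j, sg, k) \<in> ?A" "bit (nat \<bar>K v j\<bar>) k" for j sg k v
    using that by (auto simp: lanes_def sgn_if)
  have T_sub: "T m v \<subseteq> {..<w (m - 1)}" if m: "1 \<le> m" "m \<le> L" and v: "v < w m" for m v
  proof -
    consider "m = 1" | "1 < m" "m < L" | "1 < m" "m = L" using m L by linarith
    then show ?thesis
    proof cases
      case 1
      then show ?thesis by (auto simp: T_def lanes_def)
    next
      case 2
      then have m': "1 \<le> m - 1" "m - 1 < L" "v < w (Suc (m - 1))" using v by auto
      have "c (m - 1) v a h 1 < w (m - 1)" if "a \<in> ?A" for a h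
        using c(1)[OF m' that, of 1 h] G_sub[OF that m'(1,2), of h] by auto
      with 2 show ?thesis by (auto simp: T_def)
    next
      case 3
      then have m': "1 \<le> L - 1" "L - 1 < L" "v < w (Suc (L - 1))" using v by auto
      have "c (L - 1) v a False (fst (snd a) * of_int (sgn (K v (fst a)))) < w (L - 1)"
        if "a \<in> ?A" "bit (nat \<bar>K v (fst a)\<bar>) (snd (snd a))" for a
        using c(1)[OF m' that(1), of "fst (snd a) * of_int (sgn (K v (fst a)))" False]
          G_sub[OF that(1) m'(1,2), of False] sgnK[of "fst a" "fst (snd a)" "snd (snd a)" v] that
        by auto
      with 3 show ?thesis by (auto simp: T_def)
    qed
  qed
  define M where "M m = row_mask (w m) (w (m - 1)) (T m)" for m
  have carr: "relu_net (\<lambda>m. M m \<odot>\<^sub>m B m) m x \<in> carrier_vec (w m)" if "x \<in> carrier_vec (w 0)" for x m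
    using that by (intro relu_net_carrier hadamard_carrier) (simp_all add: M_def)
  have step: "relu_net (\<lambda>m. M m \<odot>\<^sub>m B m) (Suc m) x $ v =
      relu (\<Sum>u\<in>T (Suc m) v. B (Suc m) $$ (v, u) * relu_net (\<lambda>m. M m \<odot>\<^sub>m B m) m x $ u)"
    if "Suc m \<le> L" "v < w (Suc m)" "x \<in> carrier_vec (w 0)" for m v x
  proof -
    have "dim_vec ((M (Suc m) \<odot>\<^sub>m B (Suc m)) *\<^sub>v relu_net (\<lambda>m. M m \<odot>\<^sub>m B m) m x) = w (Suc m)"
      by (simp add: M_def hadamard_def row_mask_def)
    then have "relu_net (\<lambda>m. M m \<odot>\<^sub>m B m) (Suc m) x $ v =
        relu (((row_mask (w (Suc m)) (w m) (T (Suc m)) \<odot>\<^sub>m B (Suc m)) *\<^sub>v relu_net (\<lambda>m. M m \<odot>\<^sub>m B m) m x) $ v)"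
      using that(2) by (simp add: M_def)
    then show ?thesis
      using that B[of "Suc m"] carr T_sub[of "Suc m" v] by (simp add: row_mask_hadamard_mult_vec)
  qed
  \<comment> \<open>From layer 2 on this holds for every neuron of the group, chosen or not. In
    layer 1 the input sign is beyond control, hence the extra premise, which the partners chosen for
    layer 2 satisfy. Layer 1 does not double, hence \<open>m - 1\<close>.\<close>
  have inv: "relu_net (\<lambda>m. M m \<odot>\<^sub>m B m) m x $ v = 2 ^ (min k (m - 1)) * relu (sg * x $ j)"
    if "1 \<le> m" "m < L" "x \<in> carrier_vec (w 0)" "(j, sg, k) \<in> ?A" "v \<in> G ((j, sg, k), h)"
      "m = 1 \<longrightarrow> B 1 $$ (v, j) = sg" for m x j sg k h v
    using that
  proof (induction m arbitrary: j sg k h v rule: nat_induct_at_least)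
    case base
    have "T 1 v = {j}" by (simp add: T_def member[OF base.prems(3,4)])
    then show ?case using base G_sub[of "(j, sg, k)" 1 h] step[of 0 v x] by auto
  next
    case (Suc m)
    let ?a = "(j, sg, k)"
    let ?y = "relu_net (\<lambda>m. M m \<odot>\<^sub>m B m) m x"
    have v: "v < w (Suc m)" using G_sub[of ?a "Suc m" h] Suc.prems by auto
    note c' = c[OF Suc.hyps Suc_lessD[OF Suc.prems(1)] v Suc.prems(3), of 1, simplified]
    have y: "?y $ c m v ?a h' 1 = 2 ^ (min k (m - 1)) * relu (sg * x $ j)" for h'
      using Suc.prems c'(1,3)[of h'] by (intro Suc.IH[of j sg k _ h']) auto
    \<comment> \<open>Doubling needs two different neurons, since an edge cannot be kept twice; this
      is why a lane has two halves.\<close>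
    have ne: "c m v ?a False 1 \<noteq> c m v ?a True 1"
      using c'(1)[of False] c'(1)[of True] uniq Suc.prems(3) by metis
    have "T (Suc m) v = {u. u = c m v ?a False 1 \<or> m \<le> k \<and> u = c m v ?a True 1}"
      using Suc.hyps Suc.prems(1) by (simp add: T_def member[OF Suc.prems(3,4)])
    also have "\<dots> = (if m \<le> k then {c m v ?a False 1, c m v ?a True 1} else {c m v ?a False 1})" by auto
    finally have "(\<Sum>u\<in>T (Suc m) v. B (Suc m) $$ (v, u) * ?y $ u) =
        (if m \<le> k then 2 else 1) * (2 ^ (min k (m - 1)) * relu (sg * x $ j))"
      using ne y c'(2) by simp
    also have "\<dots> = 2 ^ (min k m) * relu (sg * x $ j)"
      using Suc.hyps by (cases m) (auto simp: min_def)
    finally have "relu_net (\<lambda>m. M m \<odot>\<^sub>m B m) (Suc m) x $ v = relu (2 ^ (min k m) * relu (sg * x $ j))"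
      by (simp only: step[OF less_imp_le[OF Suc.prems(1)] v Suc.prems(2)])
    \<comment> \<open>The carried value is nonnegative, so the outer ReLU leaves it
      unchanged.\<close>
    then show ?case by (simp only: relu_mult_nonneg zero_le_power zero_le_numeral relu_relu diff_Suc_1)
  qed
  have out: "relu_net (\<lambda>m. M m \<odot>\<^sub>m B m) L x =
       map_vec relu (mat (w L) (w 0) (\<lambda>(r, j). of_int (K r j)) *\<^sub>v x)" if x: "x \<in> carrier_vec (w 0)" for x
  proof (rule eq_vecI)
    show "dim_vec (relu_net (\<lambda>m. M m \<odot>\<^sub>m B m) L x) =
       dim_vec (map_vec relu (mat (w L) (w 0) (\<lambda>(r, j). of_int (K r j)) *\<^sub>v x))"
      using carr[OF x, of L] by simp
    fix r assume "r < dim_vec (map_vec relu (mat (w L) (w 0) (\<lambda>(r, j). of_int (K r j)) *\<^sub>v x))"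
    then have r: "r < w L" by simp
    let ?y = "relu_net (\<lambda>m. M m \<odot>\<^sub>m B m) (L - 1) x"
    let ?bit = "\<lambda>a. bit (nat \<bar>K r (fst a)\<bar>) (snd (snd a))"
    let ?\<nu> = "\<lambda>a. fst (snd a) * of_int (sgn (K r (fst a))) :: real"
    let ?c = "\<lambda>a. c (L - 1) r a False (?\<nu> a)"
    let ?R = "{a \<in> ?A. ?bit a}"
    have cR: "?c a \<in> G (a, False)" "B L $$ (r, ?c a) = ?\<nu> a"
      "L - 1 = 1 \<longrightarrow> B 1 $$ (?c a, fst a) = fst (snd a)" if "a \<in> ?R" for a
      using c[of "L - 1" r a "?\<nu> a" False] sgnK[of "fst a" "fst (snd a)" "snd (snd a)" r] L r that
      by auto
    have yR: "?y $ ?c a = 2 ^ snd (snd a) * relu (fst (snd a) * x $ fst a)" if "a \<in> ?R" for a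
    proof -
      have "?y $ ?c a = 2 ^ (min (snd (snd a)) (L - 1 - 1)) * relu (fst (snd a) * x $ fst a)"
        using that cR[OF that] L x by (intro inv) auto
      \<comment> \<open>Every lane has \<open>k \<le> L - 2\<close>, so by layer
        \<open>L - 1\<close> its doubling is complete.\<close>
      moreover have "min (snd (snd a)) (L - 1 - 1) = snd (snd a)"
        using that by (auto simp: lanes_def)
      ultimately show ?thesis by simp
    qed
    have TL: "T L r = ?c ` ?R"
      using L by (simp add: T_def image_def Bex_def conj_assoc del: split_paired_Ex)
    \<comment> \<open>No neuron serves two digits, so the sum over kept neurons can be reindexed by
      lanes without losing terms.\<close>
    have inj: "inj_on ?c ?R" using cR(1) uniq by (intro inj_onI) (metis (no_types, lifting) mem_Collect_eq)
    have bits: "(\<Sum>k<L - 1. of_bool (bit (nat \<bar>K r j\<bar>) k) * 2 ^ k) = real_of_int \<bar>K r j\<bar>" if "j < w 0" for j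
    proof -
      have "nat \<bar>K r j\<bar> < 2 ^ (L - 1)" using K[OF r that] by (simp add: nat_less_iff)
      from nat_eq_sum_bits[OF this] show ?thesis by simp
    qed
    have "(\<Sum>u\<in>T L r. B L $$ (r, u) * ?y $ u) = (\<Sum>a\<in>?R. B L $$ (r, ?c a) * ?y $ ?c a)"
      unfolding TL by (subst sum.reindex[OF inj]) simp
    also have "\<dots> = (\<Sum>a\<in>?R. ?\<nu> a * (2 ^ snd (snd a) * relu (fst (snd a) * x $ fst a)))"
      using cR(2) yR by (intro sum.cong refl) auto
    also have "\<dots> = (\<Sum>a\<in>?A. of_bool (?bit a) * (?\<nu> a * (2 ^ snd (snd a) * relu (fst (snd a) * x $ fst a))))"
      by (intro sum.mono_neutral_cong_left) (auto simp: lanes_def)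
    also have "\<dots> = (\<Sum>j<w 0. \<Sum>sg\<in>{-1, 1}. \<Sum>k<L - 1.
        of_bool (bit (nat \<bar>K r j\<bar>) k) * (sg * of_int (sgn (K r j)) * (2 ^ k * relu (sg * x $ j))))"
      by (simp add: lanes_def sum.cartesian_product' )
    also have "\<dots> = (\<Sum>j<w 0. of_int (K r j) * x $ j)"
    proof (intro sum.cong refl)
      fix j assume "j \<in> {..<w 0}"
      then have j: "j < w 0" by simp
      have "(\<Sum>sg\<in>{-1, 1}. \<Sum>k<L - 1.
          of_bool (bit (nat \<bar>K r j\<bar>) k) * (sg * of_int (sgn (K r j)) * (2 ^ k * relu (sg * x $ j)))) =
        (\<Sum>sg\<in>{-1, 1}. (\<Sum>k<L - 1. of_bool (bit (nat \<bar>K r j\<bar>) k) * 2 ^ k) *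
          (sg * of_int (sgn (K r j)) * relu (sg * x $ j)))"
        by (intro sum.cong refl) (simp only: sum_distrib_left sum_distrib_right mult_ac)
      also have "\<dots> = of_int (\<bar>K r j\<bar> * sgn (K r j)) * (relu (x $ j) - relu (- (x $ j)))"
        unfolding bits[OF j] by (simp add: algebra_simps)
      also have "\<bar>K r j\<bar> * sgn (K r j) = K r j" by (simp add: abs_mult_sgn mult.commute)
      also have "relu (x $ j) - relu (- (x $ j)) = x $ j" by (simp add: relu_def max_def)
      finally show "(\<Sum>sg\<in>{-1, 1}. \<Sum>k<L - 1.
          of_bool (bit (nat \<bar>K r j\<bar>) k) * (sg * of_int (sgn (K r j)) * (2 ^ k * relu (sg * x $ j)))) =
          of_int (K r j) * x $ j" .
    qed
    also have "\<dots> = (mat (w L) (w 0) (\<lambda>(r, j). of_int (K r j)) *\<^sub>v x) $ r"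
      using r x by (simp add: scalar_prod_def atLeast0LessThan)
    finally have "(\<Sum>u\<in>T L r. B L $$ (r, u) * ?y $ u) =
        (mat (w L) (w 0) (\<lambda>(r, j). of_int (K r j)) *\<^sub>v x) $ r" .
    then show "relu_net (\<lambda>m. M m \<odot>\<^sub>m B m) L x $ r =
       map_vec relu (mat (w L) (w 0) (\<lambda>(r, j). of_int (K r j)) *\<^sub>v x) $ r"
      using step[of "L - 1" r x] L r x by simp
  qed
  have masks: "\<forall>m\<in>{1..L}. M m \<in> carrier_mat (w m) (w (m - 1)) \<and> elements_mat (M m) \<subseteq> {0, 1}"
    using elements_row_mask by (simp add: M_def)
  have nets: "\<forall>x\<in>carrier_vec (w 0). relu_net (\<lambda>m. M m \<odot>\<^sub>m B m) L x =
       map_vec relu (mat (w L) (w 0) (\<lambda>(r, j). of_int (K r j)) *\<^sub>v x)"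
    using out by (rule ballI)
  show ?thesis
    by (rule exI[of _ M], rule conjI, rule masks, rule nets)
qed

section \<open>Concatenation of blocks and positive homogeneity\<close>

lemma relu_net_add: "relu_net W (a + b) x = relu_net (\<lambda>j. W (a + j)) b (relu_net W a x)"
  by (induction b) auto

lemma relu_net_cong: "(\<And>j. 1 \<le> j \<Longrightarrow> j \<le> k \<Longrightarrow> W j = V j) \<Longrightarrow> relu_net W k x = relu_net V k x"
  by (induction k) auto

lemma map_relu_smult: "0 \<le> s \<Longrightarrow> map_vec relu (s \<cdot>\<^sub>v y) = s \<cdot>\<^sub>v map_vec relu y"
  by (intro eq_vecI) (simp_all add: relu_mult_nonneg)

lemma smult_mat_mult_vec:
  assumes "A \<in> carrier_mat r c" "y \<in> carrier_vec c"
  shows "(s \<cdot>\<^sub>m A) *\<^sub>v y = s \<cdot>\<^sub>v (A *\<^sub>v (y :: real vec))"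
  using assms by (intro eq_vecI) (simp_all add: scalar_prod_def sum_distrib_left mult.assoc)

lemma scaled_relu_net_eq:
  assumes "0 \<le> s" "1 \<le> k"
    and W: "\<And>i. 1 \<le> i \<Longrightarrow> i \<le> k \<Longrightarrow> W i \<in> carrier_mat (d i) (d (i - 1))"
    and x: "x \<in> carrier_vec (d 0)"
  shows "scaled_relu_net s W k x = s \<cdot>\<^sub>v relu_net W k x"
proof -
  obtain k' where k: "k = Suc k'" using assms(2) by (cases k) auto
  have "relu_net (W(k := s \<cdot>\<^sub>m W k)) k' x = relu_net W k' x"
    by (rule relu_net_cong) (auto simp: k)
  moreover have "relu_net W k' x \<in> carrier_vec (d k')"
    using W x by (intro relu_net_carrier) (auto simp: k)
  moreover have "W k \<in> carrier_mat (d k) (d k')" using W[of k] by (simp add: k)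
  ultimately show ?thesis
    unfolding scaled_relu_net_def using assms(1)
    by (simp add: k smult_mat_mult_vec map_relu_smult)
qed

lemma relu_net_smult_layers:
  assumes s: "0 \<le> s"
    and K: "\<And>i. 1 \<le> i \<Longrightarrow> i \<le> l \<Longrightarrow> K i \<in> carrier_mat (d i) (d (i - 1))" and x: "x \<in> carrier_vec (d 0)"
  shows "relu_net (\<lambda>i. s \<cdot>\<^sub>m K i) l x = s ^ l \<cdot>\<^sub>v relu_net K l x"
  using K
proof (induction l)
  case (Suc l)
  have z: "relu_net K l x \<in> carrier_vec (d l)" using Suc.prems x by (intro relu_net_carrier) auto
  have "K (Suc l) \<in> carrier_mat (d (Suc l)) (d l)" using Suc.prems[of "Suc l"] by simp
  then have "(s \<cdot>\<^sub>m K (Suc l)) *\<^sub>v (s ^ l \<cdot>\<^sub>v relu_net K l x) = s ^ Suc l \<cdot>\<^sub>v (K (Suc l) *\<^sub>v relu_net K l x)"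
    using z by (subst smult_mat_mult_vec) (auto simp: mult_mat_vec smult_smult_assoc)
  with Suc s show ?case by (simp add: map_relu_smult del: power_Suc)
qed simp

lemma finite_lanes [simp]: "finite (lanes n L)"
  by (simp add: lanes_def)

lemma card_lanes: "card (lanes n L) = 2 * n * (L - 1)"
  by (simp add: lanes_def card_cartesian_product)

lemma rich_blocks_simulate_integer_net:
  fixes K :: "nat \<Rightarrow> nat \<Rightarrow> nat \<Rightarrow> int"
  assumes L: "2 \<le> L"
    and w: "\<And>i. i \<le> l \<Longrightarrow> w (i * L) = d i"
    and B: "\<And>j. 1 \<le> j \<Longrightarrow> j \<le> l * L \<Longrightarrow> B j \<in> carrier_mat (w j) (w (j - 1))"
    and G_disj: "\<And>i. i < l \<Longrightarrow> disjoint_family_on (G i) (lanes (d i) L \<times> UNIV)"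
    and G_sub: "\<And>i a h m. i < l \<Longrightarrow> a \<in> lanes (d i) L \<Longrightarrow> 1 \<le> m \<Longrightarrow> m < L \<Longrightarrow>
                  G i (a, h) \<subseteq> {..<w (i * L + m)}"
    and rich: "\<And>i. i < l \<Longrightarrow> rich_block (d i) L (\<lambda>m. w (i * L + m)) (G i) (\<lambda>m. B (i * L + m))"
    and K: "\<And>i r j. 1 \<le> i \<Longrightarrow> i \<le> l \<Longrightarrow> r < d i \<Longrightarrow> j < d (i - 1) \<Longrightarrow> \<bar>K i r j\<bar> < 2 ^ (L - 1)"
  shows "\<exists>M\<in>pruning_masks w (l * L). \<forall>x\<in>carrier_vec (d 0).
    relu_net (\<lambda>j. M j \<odot>\<^sub>m B j) (l * L) x =
    relu_net (\<lambda>i. mat (d i) (d (i - 1)) (\<lambda>(r, j). of_int (K i r j))) l x"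
proof -
  let ?K = "\<lambda>i. mat (d i) (d (i - 1)) (\<lambda>(r, j). real_of_int (K i r j))"
  have in_block: "i * L + m \<le> l * L" if "i < l" "m \<le> L" for i m
  proof -
    have "i * L + L = Suc i * L" by simp
    also have "\<dots> \<le> l * L" using that(1) by (intro mult_le_mono1) simp
    finally show ?thesis using that(2) by linarith
  qed
  have "\<forall>i\<in>{..<l}. \<exists>M. (\<forall>m\<in>{1..L}. M m \<in> carrier_mat (w (i * L + m)) (w (i * L + (m - 1))) \<and>
        elements_mat (M m) \<subseteq> {0, 1}) \<and>
      (\<forall>x\<in>carrier_vec (d i). relu_net (\<lambda>m. M m \<odot>\<^sub>m B (i * L + m)) L x =
         map_vec relu (?K (Suc i) *\<^sub>v x))"
  proof
    fix i assume "i \<in> {..<l}"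
    then have i: "i < l" by simp
    have ends: "w (i * L + 0) = d i" "w (i * L + L) = d (Suc i)"
      using w[of i] w[of "Suc i"] i by (simp_all add: add.commute)
    have "\<exists>M. (\<forall>m\<in>{1..L}. M m \<in> carrier_mat (w (i * L + m)) (w (i * L + (m - 1))) \<and>
        elements_mat (M m) \<subseteq> {0, 1}) \<and>
      (\<forall>x\<in>carrier_vec (w (i * L + 0)). relu_net (\<lambda>m. M m \<odot>\<^sub>m B (i * L + m)) L x =
         map_vec relu (mat (w (i * L + L)) (w (i * L + 0)) (\<lambda>(r, j). real_of_int (K (Suc i) r j)) *\<^sub>v x))"
    proof (rule rich_block_simulates_integer_layer[where w = "\<lambda>m. w (i * L + m)" and G = "G i"])
      show "B (i * L + m) \<in> carrier_mat (w (i * L + m)) (w (i * L + (m - 1)))" if "1 \<le> m" "m \<le> L" for m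
        using B[of "i * L + m"] in_block[OF i that(2)] that by simp
      show "disjoint_family_on (G i) (lanes (w (i * L + 0)) L \<times> UNIV)"
        unfolding ends by (rule G_disj[OF i])
      show "G i (a, h) \<subseteq> {..<w (i * L + m)}" if "a \<in> lanes (w (i * L + 0)) L" "1 \<le> m" "m < L" for a h m
        using G_sub[OF i] that unfolding ends by blast
      show "rich_block (w (i * L + 0)) L (\<lambda>m. w (i * L + m)) (G i) (\<lambda>m. B (i * L + m))"
        unfolding ends by (rule rich[OF i])
      show "\<bar>K (Suc i) r j\<bar> < 2 ^ (L - 1)" if "r < w (i * L + L)" "j < w (i * L + 0)" for r j
        using K[of "Suc i" r j] i that unfolding ends by simp
    qed (rule L)
    then show "\<exists>M. (\<forall>m\<in>{1..L}. M m \<in> carrier_mat (w (i * L + m)) (w (i * L + (m - 1))) \<and>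
        elements_mat (M m) \<subseteq> {0, 1}) \<and>
      (\<forall>x\<in>carrier_vec (d i). relu_net (\<lambda>m. M m \<odot>\<^sub>m B (i * L + m)) L x =
         map_vec relu (?K (Suc i) *\<^sub>v x))"
      unfolding ends by simp
  qed
  from bchoice[OF this] obtain N where N_all: "\<forall>i\<in>{..<l}.
      (\<forall>m\<in>{1..L}. N i m \<in> carrier_mat (w (i * L + m)) (w (i * L + (m - 1))) \<and>
        elements_mat (N i m) \<subseteq> {0, 1}) \<and>
      (\<forall>x\<in>carrier_vec (d i). relu_net (\<lambda>m. N i m \<odot>\<^sub>m B (i * L + m)) L x =
         map_vec relu (?K (Suc i) *\<^sub>v x))" ..
  have N: "N i m \<in> carrier_mat (w (i * L + m)) (w (i * L + (m - 1))) \<and> elements_mat (N i m) \<subseteq> {0, 1}"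
    if "i < l" "m \<in> {1..L}" for i m
    using bspec[OF N_all, of i] that by blast
  have N_net: "relu_net (\<lambda>m. N i m \<odot>\<^sub>m B (i * L + m)) L x = map_vec relu (?K (Suc i) *\<^sub>v x)"
    if "i < l" "x \<in> carrier_vec (d i)" for i x
    using bspec[OF N_all, of i] that by blast
  \<comment> \<open>Layers are numbered from 1 and block \<open>i\<close> ends with layer
    \<open>i * L + L\<close>, hence the shift by one before dividing.\<close>
  define M where "M j = N ((j - 1) div L) ((j - 1) mod L + 1)" for j
  have M: "M (i * L + m) = N i m" if "1 \<le> m" "m \<le> L" for i m
  proof -
    have eq: "i * L + m - 1 = (m - 1) + i * L" "m - 1 < L" using that L by linarith+
    have "(i * L + m - 1) div L = i" "(i * L + m - 1) mod L = m - 1"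
      unfolding eq(1) using eq(2) by simp_all
    then show ?thesis unfolding M_def using that(1) by simp
  qed
  have "M \<in> pruning_masks w (l * L)"
    unfolding pruning_masks_def
  proof (intro CollectI ballI)
    fix j assume j: "j \<in> {1..l * L}"
    define i m where "i = (j - 1) div L" and "m = (j - 1) mod L + 1"
    have "(j - 1) div L * L + (j - 1) mod L = j - 1" by (rule div_mult_mod_eq)
    then have jm: "j = i * L + m" and jm1: "j - 1 = i * L + (m - 1)"
      unfolding i_def m_def using j by simp_all
    have "(j - 1) mod L < L" using L by (intro mod_less_divisor) simp
    then have m: "1 \<le> m" "m \<le> L" unfolding m_def by simp_all
    have "j - 1 < l * L" using j[unfolded atLeastAtMost_iff] by linarith
    then have i: "i < l" unfolding i_def by (rule less_mult_imp_div_less)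
    have "M j = N i m" unfolding jm by (rule M[OF m])
    then show "M j \<in> carrier_mat (w j) (w (j - 1)) \<and> elements_mat (M j) \<subseteq> {0, 1}"
      using N[OF i, of m] m unfolding jm1 by (simp add: jm)
  qed
  moreover have "relu_net (\<lambda>j. M j \<odot>\<^sub>m B j) (i * L) x = relu_net ?K i x \<and> relu_net ?K i x \<in> carrier_vec (d i)"
    if "i \<le> l" "x \<in> carrier_vec (d 0)" for i x
    using that
  proof (induction i)
    case (Suc i)
    have "relu_net (\<lambda>j. M j \<odot>\<^sub>m B j) (i * L + L) x =
        relu_net (\<lambda>m. M (i * L + m) \<odot>\<^sub>m B (i * L + m)) L (relu_net ?K i x)"
      using Suc by (simp add: relu_net_add)
    also have "\<dots> = relu_net (\<lambda>m. N i m \<odot>\<^sub>m B (i * L + m)) L (relu_net ?K i x)"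
      by (rule relu_net_cong) (simp add: M)
    also have "\<dots> = relu_net ?K (Suc i) x"
      using Suc by (simp add: N_net)
    finally have "relu_net (\<lambda>j. M j \<odot>\<^sub>m B j) (Suc i * L) x = relu_net ?K (Suc i) x"
      by (simp add: add.commute)
    moreover have "relu_net ?K (Suc i) x \<in> carrier_vec (d (Suc i))" by (simp add: carrier_vecI)
    ultimately show ?case ..
  qed auto
  ultimately show ?thesis by blast
qed

section \<open>Union bound over neurons, lanes and signs\<close>

lemma prob_no_good_neuron:
  fixes \<nu> sg :: real
  assumes S: "finite S" and A: "finite A" and j0: "j0 \<noteq> j"
    and sub: "\<And>u. u \<in> S \<Longrightarrow> (j, v, u) \<in> A \<and> (first \<longrightarrow> (j0, u, c) \<in> A)"
    and signs: "\<nu> \<in> {-1, 1}" "sg \<in> {-1, 1}"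
  shows "measure_pmf.prob (Pi_pmf A dflt (\<lambda>_. pmf_of_set {-1, 1}))
    {s. \<forall>u\<in>S. \<not> (s (j, v, u) = \<nu> \<and> (first \<longrightarrow> s (j0, u, c) = sg))} \<le> (3 / 4) ^ card S"
proof -
  let ?D = "\<lambda>u. {(j, v, u)} \<union> (if first then {(j0, u, c)} else {})"
  let ?\<tau> = "\<lambda>(j', r, c). if j' = j then \<nu> else sg"
  have "measure_pmf.prob (Pi_pmf A dflt (\<lambda>_. pmf_of_set {-1, 1}))
      {s. \<forall>u\<in>S. \<exists>e\<in>?D u. s e \<noteq> ?\<tau> e} \<le> (3 / 4) ^ card S"
  proof (rule prob_all_patterns_wrong[OF S A])
    \<comment> \<open>The candidate \<open>u\<close> is the column of one entry and the row of the
      other, and these lie in different matrices, so candidates share no entry.\<close>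
    show "disjoint_family_on ?D S" using j0 by (auto simp: disjoint_family_on_def)
    show "?D u \<subseteq> A \<and> card (?D u) \<le> 2 \<and> (\<forall>e\<in>?D u. ?\<tau> e \<in> {-1, 1})" if "u \<in> S" for u
      using sub[OF that] signs j0 by (auto simp: card_insert_if)
  qed
  also have "{s. \<forall>u\<in>S. \<exists>e\<in>?D u. s e \<noteq> ?\<tau> e} =
      {s. \<forall>u\<in>S. \<not> (s (j, v, u) = \<nu> \<and> (first \<longrightarrow> s (j0, u, c) = sg))}"
    using j0 by auto
  finally show ?thesis .
qed

text \<open>A failure is indexed by block, layer, target neuron, lane, half and sign: at most
  \<open>l\<close>, \<open>L\<close>, \<open>W\<close>, \<open>2 * D * L\<close>, 2 and 2 choices,
  whence the factors 8 and \<open>L ^ 2\<close>. The matrix shapes, which hold for every draw, are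
  kept in the event so that an arbitrary member of it can be used afterwards.\<close>

lemma prob_all_blocks_rich:
  assumes L: "2 \<le> L"
    and w: "\<And>i. i \<le> l \<Longrightarrow> w (i * L) = d i" "\<And>j. j \<le> l * L \<Longrightarrow> w j \<le> W"
    and D: "\<And>i. i < l \<Longrightarrow> d i \<le> D"
    and G_sub: "\<And>i a h m. i < l \<Longrightarrow> a \<in> lanes (d i) L \<Longrightarrow> 1 \<le> m \<Longrightarrow> m < L \<Longrightarrow>
                  G i (a, h) \<subseteq> {..<w (i * L + m)}"
    and G_card: "\<And>i a h. i < l \<Longrightarrow> a \<in> lanes (d i) L \<Longrightarrow> card (G i (a, h)) = s"
  shows "measure_pmf.prob (random_sign_layers w (l * L))
     {B. (\<forall>j. B j \<in> carrier_mat (w j) (w (j - 1))) \<and>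
         (\<forall>i<l. rich_block (d i) L (\<lambda>m. w (i * L + m)) (G i) (\<lambda>m. B (i * L + m)))}
     \<ge> 1 - 8 * real l * real L ^ 2 * real W * real D * (3 / 4) ^ s"
proof -
  define E where "E = {(j, r, c). j \<in> {1..l * L} \<and> r < w j \<and> c < w (j - 1)}"
  let ?P = "Pi_pmf E 0 (\<lambda>_. pmf_of_set {-1, 1 :: real})"
  let ?B = "\<lambda>s j. mat (w j) (w (j - 1)) (\<lambda>(r, c). s (j, r, c) :: real)"
  define I where "I = {(i, m, v, a, h :: bool, \<nu> :: real). i < l \<and> m \<in> {1..<L} \<and> v < w (i * L + Suc m) \<and>
      a \<in> lanes (d i) L \<and> \<nu> \<in> {-1, 1}}"
  define bad where "bad = (\<lambda>(i, m, v, a, h :: bool, \<nu>).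
    {s. \<forall>u\<in>G i (a, h). \<not> (s (i * L + Suc m, v, u) = \<nu> \<and>
        (m = 1 \<longrightarrow> s (i * L + 1, u, fst a) = fst (snd a)))})"
  have in_net: "i * L + m \<le> l * L" if "i < l" "m \<le> L" for i m
  proof -
    have "i * L + L = Suc i * L" by simp
    also have "\<dots> \<le> l * L" using that(1) by (intro mult_le_mono1) simp
    finally show ?thesis using that(2) by linarith
  qed
  have E: "finite E"
  proof (rule finite_subset)
    show "E \<subseteq> {1..l * L} \<times> {..<W} \<times> {..<W}"
      unfolding E_def using w(2) by (fastforce intro: less_le_trans)
  qed auto
  have I_sub: "I \<subseteq> {..<l} \<times> {1..<L} \<times> {..<W} \<times> lanes D L \<times> UNIV \<times> {-1, 1}"
  proof
    fix z assume "z \<in> I"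
    then obtain i m v a h \<nu> where z: "z = (i, m, v, a, h, \<nu>)" "i < l" "m \<in> {1..<L}"
        "v < w (i * L + Suc m)" "a \<in> lanes (d i) L" "\<nu> \<in> {-1, 1}"
      unfolding I_def by blast
    have "w (i * L + Suc m) \<le> W" using z(2,3) by (intro w(2) in_net) auto
    then have "v < W" using z(4) by linarith
    moreover have "a \<in> lanes D L" using z(5) D[OF z(2)] by (auto simp: lanes_def)
    ultimately show "z \<in> {..<l} \<times> {1..<L} \<times> {..<W} \<times> lanes D L \<times> UNIV \<times> {-1, 1}"
      using z by simp
  qed
  have fin_prod: "finite ({..<l} \<times> {1..<L} \<times> {..<W} \<times> lanes D L \<times> (UNIV :: bool set) \<times> {-1, 1 :: real})"
    by (simp add: lanes_def)
  have I: "finite I" by (rule finite_subset[OF I_sub fin_prod])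
  have "card I \<le> l * ((L - 1) * (W * ((D * (2 * (L - 1))) * (2 * 2))))"
    using card_mono[OF fin_prod I_sub] by (simp add: card_cartesian_product card_lanes algebra_simps)
  also have "\<dots> = 8 * l * ((L - 1) * (L - 1)) * W * D" by simp
  also have "\<dots> \<le> 8 * l * (L * L) * W * D" by (intro mult_le_mono) auto
  finally have card_I: "real (card I) \<le> 8 * real l * real L ^ 2 * real W * real D"
    unfolding power2_eq_square by (metis (mono_tags) of_nat_le_iff of_nat_mult of_nat_numeral)
  have bad: "measure_pmf.prob ?P (bad z) \<le> (3 / 4) ^ s" if "z \<in> I" for z
  proof -
    obtain i m v a h \<nu> where z: "z = (i, m, v, a, h, \<nu>)" by (cases z)
    have i: "i < l" and m: "1 \<le> m" "m < L" and v: "v < w (i * L + Suc m)"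
      and a: "a \<in> lanes (d i) L" and \<nu>: "\<nu> \<in> {-1, 1}"
      using that by (auto simp: I_def z)
    have Gm: "G i (a, h) \<subseteq> {..<w (i * L + m)}" by (rule G_sub[OF i a m])
    have "measure_pmf.prob ?P (bad z) \<le> (3 / 4) ^ card (G i (a, h))"
      unfolding bad_def z prod.case
    proof (rule prob_no_good_neuron[OF _ E])
      show "finite (G i (a, h))" using Gm by (rule finite_subset) simp
      show "i * L + 1 \<noteq> i * L + Suc m" using m by simp
      show "fst (snd a) \<in> {-1, 1}" using a by (auto simp: lanes_def)
      fix u assume u: "u \<in> G i (a, h)"
      have "fst a < w (i * L)" using a i w(1)[of i] by (auto simp: lanes_def)
      with u Gm v in_net[OF i, of "Suc m"] m in_net[OF i, of 1]
      show "(i * L + Suc m, v, u) \<in> E \<and> (m = 1 \<longrightarrow> (i * L + 1, u, fst a) \<in> E)"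
        by (auto simp: E_def)
    qed (rule \<nu>)
    then show ?thesis by (simp add: G_card[OF i a])
  qed
  have rich: "rich_block (d i) L (\<lambda>m. w (i * L + m)) (G i) (\<lambda>m. ?B s (i * L + m))"
    if s: "s \<notin> (\<Union>z\<in>I. bad z)" and i: "i < l" for s i
    unfolding rich_block_def
  proof (intro ballI allI impI)
    fix m v a h and \<nu> :: real
    assume m: "m \<in> {1..<L}" and v: "v < w (i * L + Suc m)" and a: "a \<in> lanes (d i) L" and \<nu>: "\<nu> \<in> {-1, 1}"
    then have "(i, m, v, a, h, \<nu>) \<in> I" using i by (simp add: I_def)
    then obtain u where u: "u \<in> G i (a, h)" "s (i * L + Suc m, v, u) = \<nu>"
        "m = 1 \<longrightarrow> s (i * L + 1, u, fst a) = fst (snd a)"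
    proof -
      assume *: "\<And>u. u \<in> G i (a, h) \<Longrightarrow> s (i * L + Suc m, v, u) = \<nu> \<Longrightarrow>
        m = 1 \<longrightarrow> s (i * L + 1, u, fst a) = fst (snd a) \<Longrightarrow> thesis"
      have "s \<notin> bad (i, m, v, a, h, \<nu>)" using s \<open>(i, m, v, a, h, \<nu>) \<in> I\<close> by blast
      then show thesis unfolding bad_def prod.case using * by blast
    qed
    have "u < w (i * L + m)" using G_sub[OF i a, of m h] m u(1) by auto
    moreover have "fst a < w (i * L)" using a i w(1)[of i] by (auto simp: lanes_def)
    ultimately show "\<exists>u\<in>G i (a, h). ?B s (i * L + Suc m) $$ (v, u) = \<nu> \<and>
        (m = 1 \<longrightarrow> ?B s (i * L + 1) $$ (u, fst a) = fst (snd a))"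
      using u v by (intro bexI[of _ u]) auto
  qed
  have "measure_pmf.prob ?P (\<Union>z\<in>I. bad z) \<le> (\<Sum>z\<in>I. measure_pmf.prob ?P (bad z))"
    by (rule measure_pmf.finite_measure_subadditive_finite[OF I]) simp
  also have "\<dots> \<le> real (card I) * (3 / 4) ^ s"
    using sum_bounded_above[of I "\<lambda>z. measure_pmf.prob ?P (bad z)" "(3 / 4) ^ s"] bad by simp
  also have "\<dots> \<le> 8 * real l * real L ^ 2 * real W * real D * (3 / 4) ^ s"
    by (intro mult_right_mono card_I) simp
  finally have "1 - 8 * real l * real L ^ 2 * real W * real D * (3 / 4) ^ s
      \<le> measure_pmf.prob ?P (UNIV - (\<Union>z\<in>I. bad z))"
    using measure_pmf.prob_compl[of "\<Union>z\<in>I. bad z" ?P] by simp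
  also have "\<dots> \<le> measure_pmf.prob ?P {s. (\<forall>j. ?B s j \<in> carrier_mat (w j) (w (j - 1))) \<and>
         (\<forall>i<l. rich_block (d i) L (\<lambda>m. w (i * L + m)) (G i) (\<lambda>m. ?B s (i * L + m)))}"
    using rich by (intro measure_pmf.finite_measure_mono) auto
  finally show ?thesis
    unfolding random_sign_layers_def by (simp add: vimage_def E_def)
qed

section \<open>Choice of the constants\<close>

text \<open>
  A block of depth \<open>L\<close> represents the integers up to \<open>2 ^ (L - 1) - 1\<close>, and rounding needs those up
  to \<open>p + 1 / 2\<close>.  A base this close to 1 ensures it even for \<open>p\<close> close to 1, where the depth
  is truncated to 2.
\<close>

definition log_base :: real where "log_base = 2 powr (1 / 8)"

lemma log_log_base: "log log_base x = 8 * log 2 x"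
  by (simp add: log_def log_base_def ln_powr)

lemma abs_round_less_capacity:
  assumes p: "1 < p" and L: "L = nat \<lfloor>max 2 (log log_base p)\<rfloor>" and y: "\<bar>y\<bar> \<le> p"
  shows "\<bar>round y\<bar> < 2 ^ (L - 1)"
proof -
  have L2: "2 \<le> L" unfolding L by linarith
  have round: "\<bar>real_of_int (round y)\<bar> \<le> p + 1 / 2"
    using of_int_round_abs_le[of y] y by linarith
  have "\<bar>real_of_int (round y)\<bar> < 2 ^ (L - 1)"
  \<comment> \<open>Below 3/2 the rounded value stays below 2, the capacity of a block of the
    minimal depth 2.\<close>
  proof (cases "p < 3 / 2")
    case True
    have "(2 :: real) ^ 1 \<le> 2 ^ (L - 1)" using L2 by (intro power_increasing) auto
    then show ?thesis using round True by simp
  next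
    case False
    \<comment> \<open>The floor and the passage to \<open>L - 1\<close> cost less than 2 in the
      exponent, a factor 4. Since \<open>(3 / 2) ^ 7 > 17\<close>, \<open>p ^ 8 / 4\<close> still
      exceeds \<open>p + 1 / 2\<close>.\<close>
    have "8 * log 2 p - 2 < real (L - 1)"
      using L2 unfolding L log_log_base by linarith
    then have "2 powr (8 * log 2 p - 2) < 2 powr real (L - 1)" by (rule powr_less_mono) simp
    moreover have "2 powr (8 * log 2 p - 2) = p ^ 8 / 4"
    proof -
      have "2 powr (8 * log 2 p) = (2 powr log 2 p) powr 8" by (simp add: powr_powr mult.commute)
      also have "\<dots> = p ^ 8" using p by simp
      finally show ?thesis by (simp add: powr_diff)
    qed
    moreover have "2 powr real (L - 1) = 2 ^ (L - 1)" by (rule powr_realpow) simp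
    ultimately have cap: "p ^ 8 / 4 < 2 ^ (L - 1)" by simp
    have "(3 / 2) ^ 7 \<le> p ^ 7" using False by (intro power_mono) auto
    then have "p * 17 \<le> p * p ^ 7" using p by (intro mult_left_mono) (auto simp: power_divide)
    also have "\<dots> = p ^ 8" by (simp add: power_numeral_reduce)
    finally show ?thesis using cap round p by linarith
  qed
  then have "real_of_int \<bar>round y\<bar> < real_of_int (2 ^ (L - 1))" by simp
  then show ?thesis by (simp only: of_int_less_iff)
qed

lemma log2_ge_2: "4 \<le> x \<Longrightarrow> 2 \<le> log 2 x"
  by (simp add: le_log_iff)

lemma log2_le: "0 < x \<Longrightarrow> log 2 x \<le> 2 * x"
proof -
  assume x: "0 < (x :: real)"
  have "1 / 2 \<le> ln (2 :: real)" using ln_add_one_self_le_self2 ln2_ge_two_thirds by linarith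
  then have "x \<le> 2 * x * ln 2" using x by simp
  moreover have "ln x \<le> x" using ln_le_minus_one[OF x] by linarith
  ultimately have "ln x \<le> 2 * x * ln 2" by linarith
  then show ?thesis by (simp add: log_def divide_le_eq)
qed

text \<open>Everything is measured in powers of \<open>X\<close>: the number of failure events is at
  most \<delta> times a multiple of \<open>X ^ 3\<close>, while groups of size about
  \<open>40 * log 2 X\<close> make each as unlikely as a multiple of \<open>1 / X ^ 16\<close>. As
  \<open>X \<ge> 4\<close>, the remaining power absorbs the constants.\<close>

lemma failure_probability_le:
  fixes D l L W :: nat and lp \<delta> :: real
  defines "X \<equiv> real D * real l * lp ^ 2 / \<delta>"
  assumes "1 \<le> D" "1 \<le> l" "2 \<le> lp" "0 < \<delta>" "\<delta> < 1" "real L \<le> lp"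
    "real W \<le> 320 * real D * lp * log 2 X"
  shows "8 * real l * real L ^ 2 * real W * real D * (3 / 4) ^ nat \<lfloor>40 * log 2 X\<rfloor> \<le> \<delta>"
proof -
  define t where "t = log 2 X"
  define Y where "Y = real D * real l * lp ^ 2"
  have Dl: "1 \<le> real D" "1 \<le> real l" using assms(2,3) by auto
  have "1 * 1 * 2 ^ 2 \<le> Y" unfolding Y_def using Dl assms(4) by (intro mult_mono power_mono) auto
  then have Y4: "4 \<le> Y" by simp
  have XY: "X * \<delta> = Y" unfolding X_def Y_def using assms(5) by simp
  have YX: "Y \<le> X" unfolding X_def Y_def[symmetric] using Y4 assms(5,6) by (simp add: le_divide_eq mult_le_cancel_left1)
  have X4: "4 \<le> X" using Y4 YX by simp
  have t2: "2 \<le> t" unfolding t_def by (rule log2_ge_2[OF X4])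
  have tX: "t \<le> 2 * X" unfolding t_def using X4 by (intro log2_le) simp
  have "(3 / 4 :: real) ^ nat \<lfloor>40 * t\<rfloor> = (3 / 4) powr real (nat \<lfloor>40 * t\<rfloor>)"
    by (rule powr_realpow[symmetric]) simp
  also have "\<dots> \<le> (3 / 4) powr (40 * t - 1)" by (rule powr_mono') (linarith | simp)+
  also have "\<dots> = 4 / 3 * (3 / 4) powr (40 * t)" by (simp add: powr_diff)
  also have "(3 / 4 :: real) powr (40 * t) \<le> 1 / X ^ 16"
  proof -
    \<comment> \<open>Origin of the 16: with this comparison, an exponent in \<open>log 2 X\<close>
      becomes a power of \<open>X\<close>.\<close>
    have "(3 / 4 :: real) ^ 40 \<le> (1 / 2) ^ 16" by (simp add: power_divide)
    then have *: "(3 / 4 :: real) powr 40 \<le> 2 powr - 16" by (simp add: powr_minus_divide power_divide)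
    have "(3 / 4 :: real) powr (40 * t) = ((3 / 4) powr 40) powr t" by (simp only: powr_powr)
    also have "\<dots> \<le> (2 powr - 16) powr t" using * t2 by (intro powr_mono2) auto
    also have "\<dots> = (2 powr t) powr - 16" by (simp only: powr_powr mult.commute)
    also have "2 powr t = X" unfolding t_def using X4 by (intro powr_log_cancel) auto
    also have "X powr - 16 = 1 / X ^ 16" using X4 by (simp add: powr_minus_divide)
    finally show ?thesis .
  qed
  finally have small: "(3 / 4) ^ nat \<lfloor>40 * t\<rfloor> \<le> 4 / (3 * X ^ 16)" by simp
  have lp0: "0 \<le> lp" and t0: "0 \<le> t" and X0: "0 \<le> X" and Y0: "0 \<le> Y"
    using assms(4) t2 X4 Y4 by simp_all
  have "1 * 1 \<le> real l * lp" using Dl assms(4) by (intro mult_mono) auto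
  then have "real D * lp * 1 \<le> real D * lp * (real l * lp)"
    using lp0 by (intro mult_left_mono) auto
  then have "real D * lp \<le> real D * lp * (real l * lp)" by simp
  also have "\<dots> = Y" by (simp add: Y_def power2_eq_square)
  finally have DlpX: "real D * lp \<le> X" using YX by simp
  have "real L ^ 2 * real W \<le> lp ^ 2 * (320 * real D * lp * t)"
    using assms(7,8) by (intro mult_mono power_mono) (auto simp: t_def)
  then have "8 * real l * real D * (real L ^ 2 * real W) \<le>
      8 * real l * real D * (lp ^ 2 * (320 * real D * lp * t))"
    by (rule mult_left_mono) simp
  also have "\<dots> = 2560 * (Y * ((real D * lp) * t))" by (simp add: Y_def)
  also have "\<dots> \<le> 2560 * (Y * (X * (2 * X)))"
    by (intro mult_left_mono mult_mono[OF DlpX tX X0 t0] Y0) simp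
  \<comment> \<open>Trading \<open>Y\<close> for \<open>X * \<delta>\<close> is what brings out the
    target probability: the \<delta> inside the logarithm pays for it.\<close>
  also have "\<dots> = \<delta> * (5120 * X ^ 3)" by (simp add: XY[symmetric] power3_eq_cube)
  finally have "8 * real l * real D * (real L ^ 2 * real W) \<le> \<delta> * (5120 * X ^ 3)" .
  then have count: "8 * real l * real L ^ 2 * real W * real D \<le> \<delta> * (5120 * X ^ 3)"
    by (simp only: mult_ac)
  have "(4 :: real) ^ 7 \<le> X ^ 7" using X4 by (intro power_mono) auto
  also have "\<dots> \<le> X ^ 13" using X4 by (intro power_increasing) auto
  finally have "5120 * 4 \<le> 3 * X ^ 13" by simp
  then have "X ^ 3 * (5120 * 4) \<le> X ^ 3 * (3 * X ^ 13)" using X0 by (intro mult_left_mono) auto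
  moreover have "X ^ 3 * X ^ 13 = X ^ 16" by (simp only: power_add[symmetric]) simp
  ultimately have "5120 * X ^ 3 * 4 \<le> 3 * X ^ 16" by linarith
  then have one: "5120 * X ^ 3 * (4 / (3 * X ^ 16)) \<le> 1" using X4 by (simp add: divide_le_eq)
  have "8 * real l * real L ^ 2 * real W * real D * (3 / 4) ^ nat \<lfloor>40 * t\<rfloor>
      \<le> \<delta> * (5120 * X ^ 3) * (4 / (3 * X ^ 16))"
    using assms(5) X0 by (intro mult_mono[OF count small]) auto
  also have "\<dots> = \<delta> * (5120 * X ^ 3 * (4 / (3 * X ^ 16)))" by (rule mult.assoc)
  also have "\<dots> \<le> \<delta> * 1" using one assms(5) by (intro mult_left_mono) auto
  finally show ?thesis unfolding t_def by simp
qed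

section \<open>Assembly for fixed dimensions, accuracy and confidence\<close>

lemma layer_width_block:
  assumes "2 \<le> L"
  shows "layer_width L d n (i * L) = d i"
    and "1 \<le> m \<Longrightarrow> m < L \<Longrightarrow> layer_width L d n (i * L + m) = n (i + 1)"
proof -
  show "layer_width L d n (i * L) = d i" using assms by (simp add: layer_width_def)
  assume m: "1 \<le> m" "m < L"
  then have "\<not> L dvd m" by (auto dest: dvd_imp_le)
  then have "\<not> L dvd i * L + m" by (simp add: dvd_add_right_iff)
  moreover have "(i * L + m) div L = i" using m by simp
  ultimately show "layer_width L d n (i * L + m) = n (i + 1)" by (simp add: layer_width_def)
qed

definition prunable ::
  "real \<Rightarrow> nat \<Rightarrow> (nat \<Rightarrow> nat) \<Rightarrow> real \<Rightarrow> (nat \<Rightarrow> real mat) \<Rightarrow> (real vec \<Rightarrow> real) \<Rightarrow> bool" where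
  "prunable s l' w \<epsilon> B f \<longleftrightarrow>
     (\<exists>M\<in>pruning_masks w l'. \<forall>x\<in>carrier_vec (w 0). vec_norm x \<le> 1 \<longrightarrow>
        \<bar>f x - scaled_relu_net s (\<lambda>j. M j \<odot>\<^sub>m B j) l' x $ 0\<bar> \<le> \<epsilon>)"

context
  fixes l :: nat and d :: "nat \<Rightarrow> nat" and \<epsilon> \<delta> :: real
  assumes l: "1 \<le> l" and d: "\<forall>i\<le>l. 1 \<le> d i" "d l = 1"
    and \<epsilon>: "0 < \<epsilon>" and \<delta>: "0 < \<delta>" "\<delta> < 1"
begin

abbreviation (input) "D \<equiv> max_dim l d"
abbreviation (input) "lp \<equiv> log_precision log_base l d \<epsilon>"
abbreviation (input) "depth \<equiv> block_depth log_base l d \<epsilon>"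
abbreviation (input) "X \<equiv> real D * real l * lp ^ 2 / \<delta>"

lemma d_le: "i \<le> l \<Longrightarrow> d i \<le> D"
  unfolding max_dim_def by (intro Max_ge) auto

lemma D_ge: "1 \<le> D"
  using d_le[of l] d by simp

lemma lp_ge: "2 \<le> lp" by (simp add: log_precision_def)

lemma depth_ge: "2 \<le> depth" and depth_le: "real depth \<le> lp"
proof -
  show "2 \<le> depth" unfolding block_depth_def using lp_ge by linarith
  show "real depth \<le> lp" unfolding block_depth_def using lp_ge by linarith
qed

lemma log_X_ge: "2 \<le> log 2 X"
proof -
  have "1 * 1 * 2 ^ 2 \<le> real D * real l * lp ^ 2"
    using D_ge l lp_ge by (intro mult_mono power_mono) auto
  also have "\<dots> \<le> X" using \<delta> D_ge l lp_ge
    by (simp add: le_divide_eq mult_le_cancel_left1)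
  finally show ?thesis by (intro log2_ge_2) simp
qed

lemma width_scale_eq: "width_scale log_base l d \<epsilon> \<delta> i = 8 * real (d (i - 1)) * lp * log 2 X"
  by (simp add: width_scale_def log_log_base)

lemma admissible_widths_exist: "\<exists>n. admissible_widths log_base 20 40 l d \<epsilon> \<delta> n"
proof -
  have "20 * width_scale log_base l d \<epsilon> \<delta> i \<le> real (nat \<lceil>20 * width_scale log_base l d \<epsilon> \<delta> i\<rceil>) \<and>
        real (nat \<lceil>20 * width_scale log_base l d \<epsilon> \<delta> i\<rceil>) \<le> 40 * width_scale log_base l d \<epsilon> \<delta> i"
    if "i \<in> {1..l}" for i
  proof -
    have "1 \<le> d (i - 1)" using d(1) that by auto
    \<comment> \<open>The interval from 20 to 40 times this quantity is longer than 1, so it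
      contains an integer.\<close>
    then have "8 * 1 * 2 * 2 \<le> width_scale log_base l d \<epsilon> \<delta> i"
      unfolding width_scale_eq using lp_ge log_X_ge by (intro mult_mono) auto
    then show ?thesis by linarith
  qed
  then show ?thesis unfolding admissible_widths_def by (intro exI ballI) 
qed

text \<open>Neither the layers nor the ReLU increase the norm, so target values are at most 1 and
  zero is close enough. This disposes of the range of \<epsilon> in which \<open>1 < p\<close>,
  needed for the capacity estimate, can fail.\<close>

lemma pruned_to_zero:
  assumes f: "f \<in> target_nets l d" and \<epsilon>1: "1 \<le> \<epsilon>" and s: "0 \<le> s"
    and w: "w 0 = d 0" "w l' = 1" and l': "1 \<le> l'"
  shows "prunable s l' w \<epsilon> B f"
proof -
  define M where "M j = row_mask (w j) (w (j - 1)) (\<lambda>_. {})" for j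
  have M: "M \<in> pruning_masks w l'"
    unfolding pruning_masks_def using elements_row_mask by (simp add: M_def)
  have carr: "M j \<odot>\<^sub>m B j \<in> carrier_mat (w j) (w (j - 1))" for j
    unfolding M_def by (intro hadamard_carrier row_mask_carrier)
  obtain W where W: "f = (\<lambda>x. relu_net W l x $ 0)"
    "\<forall>i\<in>{1..l}. W i \<in> carrier_mat (d i) (d (i - 1)) \<and> mat_opnorm (W i) \<le> 1"
    using f unfolding target_nets_def by blast
  have "\<bar>f x - scaled_relu_net s (\<lambda>j. M j \<odot>\<^sub>m B j) l' x $ 0\<bar> \<le> \<epsilon>"
    if x: "x \<in> carrier_vec (d 0)" "vec_norm x \<le> 1" for x
  proof -
    obtain k where k: "l' = Suc k" using l' by (cases l') auto
    have y: "relu_net (\<lambda>j. M j \<odot>\<^sub>m B j) k x \<in> carrier_vec (w k)"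
      using x(1) w(1) by (intro relu_net_carrier carr) simp
    have dim: "dim_row (M l' \<odot>\<^sub>m B l') = 1" using carr[of l'] w(2) by auto
    have "((M l' \<odot>\<^sub>m B l') *\<^sub>v relu_net (\<lambda>j. M j \<odot>\<^sub>m B j) k x) $ 0 = 0"
      unfolding M_def using row_mask_hadamard_mult_vec[OF y, of 0 1 "\<lambda>_. {}" "B l'"] w(2)
      by (simp add: k M_def)
    then have "relu_net (\<lambda>j. M j \<odot>\<^sub>m B j) l' x $ 0 = 0" using dim by (simp add: k relu_def)
    moreover have "dim_vec (relu_net (\<lambda>j. M j \<odot>\<^sub>m B j) l' x) = 1" using dim by (simp add: k)
    ultimately have "scaled_relu_net s (\<lambda>j. M j \<odot>\<^sub>m B j) l' x $ 0 = 0"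
      using scaled_relu_net_eq[OF s l', of "\<lambda>j. M j \<odot>\<^sub>m B j" w x] carr x(1) w(1) by simp
    moreover have "\<bar>f x\<bar> \<le> 1"
    proof -
      have "relu_net W l x \<in> carrier_vec (d l)" using W(2) x by (intro relu_net_carrier) auto
      then have "\<bar>f x\<bar> \<le> vec_norm (relu_net W l x)"
        unfolding W(1) using d(2) by (intro abs_vec_index_le_vec_norm) auto
      also have "\<dots> \<le> 1" using W(2) x by (intro vec_norm_relu_net_le[where d = d]) auto
      finally show ?thesis .
    qed
    ultimately show ?thesis using \<epsilon>1 by simp
  qed
  then show ?thesis unfolding prunable_def w(1) by (intro bexI[OF _ M] ballI impI)
qed

lemma rich_net_prunable:
  assumes f: "f \<in> target_nets l d" and \<epsilon>1: "\<epsilon> < 1"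
    and w: "\<And>i. i \<le> l \<Longrightarrow> w (i * depth) = d i"
    and B: "\<And>j. B j \<in> carrier_mat (w j) (w (j - 1))"
    and G_disj: "\<And>i. i < l \<Longrightarrow> disjoint_family_on (G i) (lanes (d i) depth \<times> UNIV)"
    and G_sub: "\<And>i a h m. i < l \<Longrightarrow> a \<in> lanes (d i) depth \<Longrightarrow> 1 \<le> m \<Longrightarrow> m < depth \<Longrightarrow>
                  G i (a, h) \<subseteq> {..<w (i * depth + m)}"
    and rich: "\<And>i. i < l \<Longrightarrow>
      rich_block (d i) depth (\<lambda>m. w (i * depth + m)) (G i) (\<lambda>m. B (i * depth + m))"
  shows "prunable ((\<epsilon> / (real D ^ 2 * real l)) ^ l) (l * depth) w \<epsilon> B f"
proof -
  define p where "p = precision l d \<epsilon>"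
  have "1 * 1 \<le> real D ^ 2 * real l" using D_ge l by (intro mult_mono one_le_power) auto
  then have Dl: "1 \<le> real D ^ 2 * real l" by simp
  then have p: "1 < p" unfolding p_def precision_def using \<epsilon> \<epsilon>1 by (simp add: less_divide_eq)
  have p_inv: "1 / p = \<epsilon> / (real D ^ 2 * real l)" by (simp add: p_def precision_def)
  obtain W where W: "f = (\<lambda>x. relu_net W l x $ 0)"
    "\<And>i. 1 \<le> i \<Longrightarrow> i \<le> l \<Longrightarrow> W i \<in> carrier_mat (d i) (d (i - 1)) \<and> mat_opnorm (W i) \<le> 1"
    using f unfolding target_nets_def by fastforce
  define K where "K i r j = round (p * W i $$ (r, j))" for i r j
  have K: "\<bar>K i r j\<bar> < 2 ^ (depth - 1)" if "1 \<le> i" "i \<le> l" "r < d i" "j < d (i - 1)" for i r j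
    unfolding K_def
  proof (rule abs_round_less_capacity[OF p])
    show "depth = nat \<lfloor>max 2 (log log_base p)\<rfloor>"
      by (simp add: block_depth_def log_precision_def p_def)
    have "\<bar>W i $$ (r, j)\<bar> \<le> 1" using W(2)[OF that(1,2)] that(3,4) by (intro abs_entry_le_one) auto
    then show "\<bar>p * W i $$ (r, j)\<bar> \<le> p" using p by (simp add: abs_mult mult_le_cancel_left1)
  qed
  let ?K = "\<lambda>i. mat (d i) (d (i - 1)) (\<lambda>(r, j). real_of_int (K i r j))"
  let ?V = "\<lambda>i. (1 / p) \<cdot>\<^sub>m ?K i"
  have "\<exists>M\<in>pruning_masks w (l * depth). \<forall>x\<in>carrier_vec (d 0).
      relu_net (\<lambda>j. M j \<odot>\<^sub>m B j) (l * depth) x = relu_net ?K l x"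
    by (rule rich_blocks_simulate_integer_net[where G = G])
      (rule depth_ge w B G_disj G_sub rich K; assumption)+
  then obtain M where M: "M \<in> pruning_masks w (l * depth)"
    and net: "\<And>x. x \<in> carrier_vec (d 0) \<Longrightarrow>
      relu_net (\<lambda>j. M j \<odot>\<^sub>m B j) (l * depth) x = relu_net ?K l x" by blast
  have "\<bar>f x - scaled_relu_net ((1 / p) ^ l) (\<lambda>j. M j \<odot>\<^sub>m B j) (l * depth) x $ 0\<bar> \<le> \<epsilon>"
    if x: "x \<in> carrier_vec (d 0)" "vec_norm x \<le> 1" for x
  proof -
    have "1 \<le> l * depth" using l depth_ge by simp
    moreover have "M i \<odot>\<^sub>m B i \<in> carrier_mat (w i) (w (i - 1))" if "1 \<le> i" "i \<le> l * depth" for i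
      using M that by (intro hadamard_carrier) (auto simp: pruning_masks_def)
    moreover have "x \<in> carrier_vec (w 0)" using w[of 0] x by simp
    ultimately have "scaled_relu_net ((1 / p) ^ l) (\<lambda>j. M j \<odot>\<^sub>m B j) (l * depth) x =
        (1 / p) ^ l \<cdot>\<^sub>v relu_net (\<lambda>j. M j \<odot>\<^sub>m B j) (l * depth) x"
      using p by (intro scaled_relu_net_eq) auto
    also have "\<dots> = relu_net ?V l x"
      unfolding net[OF x(1)] using p x(1) by (intro relu_net_smult_layers[symmetric, where d = d]) auto
    finally have eq: "scaled_relu_net ((1 / p) ^ l) (\<lambda>j. M j \<odot>\<^sub>m B j) (l * depth) x = relu_net ?V l x" .
    show ?thesis unfolding W(1) eq
    proof (rule rounded_net_error[where d = d and D = D])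
      fix i r c assume i: "1 \<le> i" "i \<le> l" "r < d i" "c < d (i - 1)"
      have "\<bar>W i $$ (r, c) - ?V i $$ (r, c)\<bar> = \<bar>real_of_int (K i r c) - p * W i $$ (r, c)\<bar> / p"
      proof -
        have "W i $$ (r, c) - ?V i $$ (r, c) = - ((real_of_int (K i r c) - p * W i $$ (r, c)) / p)"
          using p i by (simp add: field_simps)
        then show ?thesis using p by (simp add: abs_divide del: minus_divide_left)
      qed
      also have "\<dots> \<le> (1 / 2) / p"
        unfolding K_def using p of_int_round_abs_le by (intro divide_right_mono) auto
      also have "(1 / 2) / p = (1 / p) / 2" by simp
      also have "\<dots> = \<epsilon> / (2 * real D ^ 2 * real l)" unfolding p_inv by simp
      finally show "\<bar>W i $$ (r, c) - ?V i $$ (r, c)\<bar> \<le> \<epsilon> / (2 * real D ^ 2 * real l)" .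
    qed (use W(2) d_le D_ge l d(2) \<epsilon> \<epsilon>1 x in auto)
  qed
  moreover have "w 0 = d 0" using w[of 0] by simp
  ultimately show ?thesis
    unfolding prunable_def p_inv by (intro bexI[OF _ M] ballI impI) simp
qed

text \<open>There are \<open>4 * d i * (depth - 1)\<close> pairs of a lane and a half. With at most
  \<open>40 * log 2 X\<close> neurons each they fit into \<open>160 * d i * lp * log 2 X\<close>
  neurons, and 160 is the lower width constant 20 times the 8 from \<open>log_base\<close>.\<close>

lemma lane_groups_exist:
  assumes "admissible_widths log_base 20 40 l d \<epsilon> \<delta> n"
  shows "\<exists>G. \<forall>i\<in>{..<l}.
      disjoint_family_on (G i) (lanes (d i) depth \<times> (UNIV :: bool set)) \<and>
      (\<forall>z\<in>lanes (d i) depth \<times> UNIV.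
         card (G i z) = nat \<lfloor>40 * log 2 X\<rfloor> \<and> G i z \<subseteq> {..<n (i + 1)})"
proof -
  define s where "s = nat \<lfloor>40 * log 2 X\<rfloor>"
  have n_ge: "160 * real (d i) * lp * log 2 X \<le> real (n (i + 1))" if "i < l" for i
    using assms that unfolding admissible_widths_def width_scale_eq by (auto dest!: bspec[of _ _ "i + 1"])
  have s_le: "real s \<le> 40 * log 2 X" unfolding s_def using log_X_ge by linarith
  have groups: "card (lanes (d i) depth \<times> (UNIV :: bool set)) * s \<le> n (i + 1)" if "i < l" for i
  proof -
    have "real (card (lanes (d i) depth \<times> (UNIV :: bool set)) * s) = 4 * real (d i) * real (depth - 1) * real s"
      by (simp add: lanes_def card_cartesian_product)
    also have "\<dots> \<le> 4 * real (d i) * lp * (40 * log 2 X)"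
      using depth_le lp_ge s_le by (intro mult_mono) auto
    also have "\<dots> \<le> real (n (i + 1))" using n_ge[OF that] by simp
    finally show ?thesis by (simp only: of_nat_le_iff)
  qed
  have "\<forall>i\<in>{..<l}. \<exists>G. disjoint_family_on G (lanes (d i) depth \<times> (UNIV :: bool set)) \<and>
      (\<forall>z\<in>lanes (d i) depth \<times> UNIV. card (G z) = s \<and> G z \<subseteq> {..<n (i + 1)})"
  proof
    fix i assume "i \<in> {..<l}"
    then have i: "i < l" by simp
    have fin: "finite (lanes (d i) depth \<times> (UNIV :: bool set))" by simp
    obtain G where "disjoint_family_on G (lanes (d i) depth \<times> (UNIV :: bool set))"
      "\<And>z. z \<in> lanes (d i) depth \<times> UNIV \<Longrightarrow> card (G z) = s \<and> G z \<subseteq> {..<n (i + 1)}"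
      by (rule obtain_disjoint_groups[OF fin groups[OF i]]) (rule that; assumption)
    then show "\<exists>G. disjoint_family_on G (lanes (d i) depth \<times> (UNIV :: bool set)) \<and>
      (\<forall>z\<in>lanes (d i) depth \<times> UNIV. card (G z) = s \<and> G z \<subseteq> {..<n (i + 1)})"
      by (intro exI[of _ G] conjI ballI) simp_all
  qed
  from bchoice[OF this] show ?thesis unfolding s_def .
qed

lemma layer_width_le:
  assumes "admissible_widths log_base 20 40 l d \<epsilon> \<delta> n" and j: "j \<le> l * depth"
  shows "real (layer_width depth d n j) \<le> 320 * real D * lp * log 2 X"
proof (cases "depth dvd j")
  case True
  then obtain i where "j = depth * i" ..
  then have i: "j = i * depth" by (simp only: mult.commute)
  then have "i \<le> l" using j depth_ge by simp
  \<comment> \<open>Layers at block boundaries are not governed by admissibility; their width is at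
    most \<open>D\<close>, and the remaining factors exceed 1.\<close>
  have "1 * 2 * 2 \<le> 320 * lp * log 2 X" using lp_ge log_X_ge by (intro mult_mono) auto
  then have "1 \<le> 320 * lp * log 2 X" by simp
  then have "real D * 1 \<le> real D * (320 * lp * log 2 X)" by (rule mult_left_mono) simp
  moreover have "real (d i) \<le> real D" using d_le[OF \<open>i \<le> l\<close>] by simp
  ultimately have "real (d i) \<le> 320 * real D * lp * log 2 X" by (simp add: mult_ac)
  then show ?thesis unfolding i layer_width_block(1)[OF depth_ge] .
next
  case False
  define i m where "i = j div depth" and "m = j mod depth"
  have jm: "j = i * depth + m" by (simp add: i_def m_def)
  have m: "1 \<le> m" "m < depth" using False depth_ge by (auto simp: m_def dvd_eq_mod_eq_0 Suc_le_eq)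
  have "i * depth < l * depth" using j m(1) unfolding jm by linarith
  then have i: "i < l" by simp
  have "real (n (i + 1)) \<le> 320 * real (d i) * lp * log 2 X"
    using assms(1) i unfolding admissible_widths_def width_scale_eq by (auto dest!: bspec[of _ _ "i + 1"])
  also have "\<dots> \<le> 320 * real D * lp * log 2 X"
    using d_le[of i] i lp_ge log_X_ge by (intro mult_right_mono) auto
  finally show ?thesis unfolding jm layer_width_block(2)[OF depth_ge m] .
qed

lemma prob_prunable_large_error:
  assumes "1 \<le> \<epsilon>" "0 \<le> s"
  shows "measure_pmf.prob P {B. \<forall>f\<in>target_nets l d. prunable s (l * depth) (layer_width depth d n) \<epsilon> B f} = 1"
proof -
  have "prunable s (l * depth) (layer_width depth d n) \<epsilon> B f" if "f \<in> target_nets l d" for B f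
  proof (rule pruned_to_zero[OF that assms])
    show "layer_width depth d n 0 = d 0" using layer_width_block(1)[OF depth_ge, of d n 0] by simp
    show "layer_width depth d n (l * depth) = 1" unfolding layer_width_block(1)[OF depth_ge] by (rule d(2))
    show "1 \<le> l * depth" using l depth_ge by simp
  qed
  then show ?thesis by simp
qed

lemma prob_prunable_small_error:
  assumes n: "admissible_widths log_base 20 40 l d \<epsilon> \<delta> n" and "\<epsilon> < 1"
  defines "w \<equiv> layer_width depth d n"
  shows "1 - \<delta> \<le> measure_pmf.prob (random_sign_layers w (l * depth))
    {B. \<forall>f\<in>target_nets l d. prunable ((\<epsilon> / (real D ^ 2 * real l)) ^ l) (l * depth) w \<epsilon> B f}"
proof -
  define s where "s = nat \<lfloor>40 * log 2 X\<rfloor>"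
  define N where "N = nat \<lfloor>320 * real D * lp * log 2 X\<rfloor>"
  \<comment> \<open>The groups depend on the widths alone and are fixed before the draw, as the
    union bound requires.\<close>
  obtain G where G_all: "\<forall>i\<in>{..<l}.
      disjoint_family_on (G i) (lanes (d i) depth \<times> (UNIV :: bool set)) \<and>
      (\<forall>z\<in>lanes (d i) depth \<times> UNIV. card (G i z) = s \<and> G i z \<subseteq> {..<n (i + 1)})"
    using lane_groups_exist[OF n] unfolding s_def ..
  have w_end: "w (i * depth) = d i" for i
    unfolding w_def by (rule layer_width_block(1)[OF depth_ge])
  have G_disj: "disjoint_family_on (G i) (lanes (d i) depth \<times> (UNIV :: bool set))" if "i < l" for i
    using bspec[OF G_all, of i] that by blast
  have G: "card (G i (a, h)) = s" "G i (a, h) \<subseteq> {..<n (i + 1)}"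
    if "i < l" "a \<in> lanes (d i) depth" for i a h
    using bspec[OF G_all, of i] that by blast+
  have G_sub: "G i (a, h) \<subseteq> {..<w (i * depth + m)}"
    if "i < l" "a \<in> lanes (d i) depth" "1 \<le> m" "m < depth" for i a h m
    unfolding w_def layer_width_block(2)[OF depth_ge that(3,4)] by (rule G(2)[OF that(1,2)])
  have w_le: "w j \<le> N" if "j \<le> l * depth" for j
    unfolding N_def w_def by (rule le_nat_floor[OF layer_width_le[OF n that]])
  have d_le': "d i \<le> D" if "i < l" for i
    using that by (intro d_le) simp
  let ?rich = "{B. (\<forall>j. B j \<in> carrier_mat (w j) (w (j - 1))) \<and>
      (\<forall>i<l. rich_block (d i) depth (\<lambda>m. w (i * depth + m)) (G i) (\<lambda>m. B (i * depth + m)))}"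
  have "8 * real l * real depth ^ 2 * real N * real D * (3 / 4) ^ s \<le> \<delta>"
    unfolding s_def
  proof (rule failure_probability_le)
    have "0 \<le> 320 * real D * lp * log 2 X" using layer_width_le[OF n, of 0] by simp
    then show "real N \<le> 320 * real D * lp * log 2 X" unfolding N_def by linarith
  qed (fact D_ge l lp_ge \<delta> depth_le)+
  then have "1 - \<delta> \<le> 1 - 8 * real l * real depth ^ 2 * real N * real D * (3 / 4) ^ s" by simp
  also have "\<dots> \<le> measure_pmf.prob (random_sign_layers w (l * depth)) ?rich"
    by (rule prob_all_blocks_rich) (rule depth_ge w_end w_le d_le' G_sub G(1); assumption)+
  also have "\<dots> \<le> measure_pmf.prob (random_sign_layers w (l * depth))
    {B. \<forall>f\<in>target_nets l d. prunable ((\<epsilon> / (real D ^ 2 * real l)) ^ l) (l * depth) w \<epsilon> B f}"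
  proof (rule measure_pmf.finite_measure_mono)
    show "?rich \<subseteq> {B. \<forall>f\<in>target_nets l d.
        prunable ((\<epsilon> / (real D ^ 2 * real l)) ^ l) (l * depth) w \<epsilon> B f}"
    proof (intro subsetI CollectI ballI)
      fix B f
      assume "B \<in> ?rich" and f: "f \<in> target_nets l d"
      then have B: "\<And>j. B j \<in> carrier_mat (w j) (w (j - 1))"
        "\<And>i. i < l \<Longrightarrow> rich_block (d i) depth (\<lambda>m. w (i * depth + m)) (G i) (\<lambda>m. B (i * depth + m))"
        by blast+
      show "prunable ((\<epsilon> / (real D ^ 2 * real l)) ^ l) (l * depth) w \<epsilon> B f"
        by (rule rich_net_prunable[where G = G]) (rule f \<open>\<epsilon> < 1\<close> w_end B G_disj G_sub; assumption)+
    qed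
  qed simp
  finally show ?thesis .
qed

lemma prob_prunable:
  assumes n: "admissible_widths log_base 20 40 l d \<epsilon> \<delta> n"
  shows "1 - \<delta> \<le> measure_pmf.prob (random_sign_layers (layer_width depth d n) (l * depth))
    {B. \<forall>f\<in>target_nets l d.
       prunable ((\<epsilon> / (real D ^ 2 * real l)) ^ l) (l * depth) (layer_width depth d n) \<epsilon> B f}"
proof (cases "1 \<le> \<epsilon>")
  case True
  have "0 \<le> (\<epsilon> / (real D ^ 2 * real l)) ^ l" using \<epsilon> by simp
  from prob_prunable_large_error[OF True this] show ?thesis using \<delta> by simp
next
  case False
  then show ?thesis by (intro prob_prunable_small_error[OF n]) simp
qed

end

theorem theorem1:
  shows "\<exists>b c C :: real. 1 < b \<and> 0 < c \<and> c \<le> C \<and>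
    (\<forall>(l :: nat) (d :: nat \<Rightarrow> nat) (\<epsilon> :: real) (\<delta> :: real).
      1 \<le> l \<longrightarrow> (\<forall>i\<le>l. 1 \<le> d i) \<longrightarrow> d l = 1 \<longrightarrow> 0 < \<epsilon> \<longrightarrow> 0 < \<delta> \<longrightarrow> \<delta> < 1 \<longrightarrow>
      (\<exists>n. admissible_widths b c C l d \<epsilon> \<delta> n) \<and>
      (\<forall>n. admissible_widths b c C l d \<epsilon> \<delta> n \<longrightarrow>
        (let L = block_depth b l d \<epsilon>;
             l' = l * L;
             w = layer_width L d n;
             \<epsilon>' = (\<epsilon> / (real (max_dim l d) ^ 2 * real l)) ^ l
         in measure_pmf.prob (random_sign_layers w l')
              {B. \<forall>f\<in>target_nets l d. \<exists>M\<in>pruning_masks w l'.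
                    \<forall>x\<in>carrier_vec (d 0). vec_norm x \<le> 1 \<longrightarrow>
                      \<bar>f x - scaled_relu_net \<epsilon>' (\<lambda>j. M j \<odot>\<^sub>m B j) l' x $ 0\<bar> \<le> \<epsilon>}
            \<ge> 1 - \<delta>)))"
\<comment> \<open>The lower constant 20 provides room for the groups; the upper constant 40 admits
  an integer width and keeps the number of failure events polynomial in \<open>X\<close>.\<close>
proof (rule exI[of _ log_base], rule exI[of _ 20], rule exI[of _ 40], intro conjI allI impI)
  show "1 < log_base" by (simp add: log_base_def)
next
  fix l :: nat and d :: "nat \<Rightarrow> nat" and \<epsilon> \<delta> :: real and n
  assume *: "1 \<le> l" "\<forall>i\<le>l. 1 \<le> d i" "d l = 1" "0 < \<epsilon>" "0 < \<delta>" "\<delta> < 1"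
  show "\<exists>n. admissible_widths log_base 20 40 l d \<epsilon> \<delta> n"
    by (rule admissible_widths_exist[OF *])
  assume "admissible_widths log_base 20 40 l d \<epsilon> \<delta> n"
  have d0: "layer_width (block_depth log_base l d \<epsilon>) d n 0 = d 0" by (simp add: layer_width_def)
  from prob_prunable[OF * \<open>admissible_widths log_base 20 40 l d \<epsilon> \<delta> n\<close>]
  show "let L = block_depth log_base l d \<epsilon>;
             l' = l * L;
             w = layer_width L d n;
             \<epsilon>' = (\<epsilon> / (real (max_dim l d) ^ 2 * real l)) ^ l
         in measure_pmf.prob (random_sign_layers w l')
              {B. \<forall>f\<in>target_nets l d. \<exists>M\<in>pruning_masks w l'.
                    \<forall>x\<in>carrier_vec (d 0). vec_norm x \<le> 1 \<longrightarrow>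
                      \<bar>f x - scaled_relu_net \<epsilon>' (\<lambda>j. M j \<odot>\<^sub>m B j) l' x $ 0\<bar> \<le> \<epsilon>}
            \<ge> 1 - \<delta>"
    unfolding Let_def prunable_def d0 .
qed simp_all

end
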